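(* Let $\psi_{\alpha,\rho}$ denote the (continuous) density of the free stable distribution $\nu_{\alpha,\rho}$, $(\alpha,\rho)\in\mathcal{A}$. Assume that $\alpha\in(0,1)$ and $\rho\in[0,1]$, and put $x^*:=\alpha(1-\alpha)^{1/\alpha-1}$. Then the following convergent series representations hold: $$\psi_{\alpha,\rho}(x)=\frac1\pi\sum_{n\ge1}(-1)^{n-1}\frac{\Gamma(1+\alpha n)}{n!\,\Gamma(2+(\alpha-1)n)}\sin(n\alpha\rho\pi)\,x^{-\alpha n-1},\qquad x\ge x^*,$$ $$\psi_{\alpha,\rho}(x)=\frac1\pi\sum_{n\ge1}(-1)^{n-1}\frac{\Gamma(1+n/\alpha)}{n!\,\Gamma(2+(1/\alpha-1)n)}\sin(n\rho\pi)\,x^{n-1},\qquad 0\le x\le x^*.$$ When $\alpha\in(1,2]$ and $\rho\in[1-1/\alpha,1/\alpha]$, the corresponding series expansions of $\psi_{\alpha,\rho}(x)$ for $x>0$ are obtained by inserting the expansions $$\psi_{1/\alpha,\,\alpha\rho}(y)=\frac1\pi\sum_{n\ge1}(-1)^{n-1}\frac{\Gamma(1+n/\alpha)}{n!\,\Gamma(2+(1/\alpha-1)n)}\sin(n\rho\pi)\,y^{-n/\alpha-1},\qquad y\ge y^*,$$ $$\psi_{1/\alpha,\,\alpha\rho}(y)=\frac1\pi\sum_{n\ge1}(-1)^{n-1}\frac{\Gamma(1+\alpha n)}{n!\,\Gamma(2+(\alpha-1)n)}\sin(n\alpha\rho\pi)\,y^{n-1},\qquad 0\le y\le y^*,$$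 where $y^*:=\alpha^{-1}(1-\alpha^{-1})^{\alpha-1}$ (these are the series representations for first parameter in $(0,1)$, with $(\alpha,\rho)$ replaced by $(1/\alpha,\alpha\rho)$), into the identity $$\psi_{\alpha,\rho}(x)=x^{-\alpha-1}\,\psi_{1/\alpha,\,\alpha\rho}(x^{-\alpha}),\qquad x>0.$$ The expressions for $x<0$ follow from $\psi_{\alpha,\rho}(x)=\psi_{\alpha,1-\rho}(-x)$.
   Context: The set of admissible parameters is $$\mathcal{A}=\{(\alpha,\rho):\alpha\in(0,1),\ \rho\in[0,1]\}\cup\{(\alpha,\rho):\alpha\in(1,2],\ \rho\in[1-\alpha^{-1},\alpha^{-1}]\}.$$ All powers use the principal branch. For $(\alpha,\rho)\in\mathcal{A}$, the free stable distribution $\nu_{\alpha,\rho}$ is the probability measure on $\mathbb{R}$ (known to exist and be unique) whose Voiculescu transform is $\phi_{\alpha,\rho}(z)=-e^{\pi i\alpha\rho}z^{-\alpha+1}$ for $\operatorname{Im}(z)>0$. This means that its Cauchy transform $G_{\alpha,\rho}(z)=\int_{\mathbb{R}}\frac{\nu_{\alpha,\rho}(dx)}{z-x}$, $\operatorname{Im}(z)>0$ (which takes values in the lower half-plane), is the inverse function of $w\mapsto \frac1w+\phi_{\alpha,\rho}(\frac1w)$, i.e. $w=G_{\alpha,\rho}(z)$ satisfies $z=w^{-1}-e^{\pi i\alpha\rho}w^{\alpha-1}$ for all $z$ with $\operatorname{Im}(z)>0$. The measure $\nu_{\alpha,\rho}$ is absolutely continuous and $\psi_{\alpha,\rho}$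 denotes its continuous density. The reciprocal $1/\Gamma$ is the entire function, equal to $0$ at non-positive integers. *)

theory Defs
  imports "HOL-Probability.Probability"
begin

definition admissible_params :: "(real \<times> real) set" where
  "admissible_params =
     {(\<alpha>, \<rho>). 0 < \<alpha> \<and> \<alpha> < 1 \<and> 0 \<le> \<rho> \<and> \<rho> \<le> 1} \<union>
     {(\<alpha>, \<rho>). 1 < \<alpha> \<and> \<alpha> \<le> 2 \<and> 1 - 1 / \<alpha> \<le> \<rho> \<and> \<rho> \<le> 1 / \<alpha>}"

definition cauchy_transform :: "real measure \<Rightarrow> complex \<Rightarrow> complex" where
  "cauchy_transform \<nu> z = (\<integral>x. 1 / (z - of_real x) \<partial>\<nu>)"

text \<open>
  Only for functions \<open>\<phi>\<close> given on the whole upper half-plane (the freely infinitely divisible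
  case). The Cauchy transform maps the upper into the lower half-plane, so \<open>\<phi>\<close> is evaluated
  in the upper half-plane only.
\<close>

definition has_voiculescu_transform :: "real measure \<Rightarrow> (complex \<Rightarrow> complex) \<Rightarrow> bool" where
  "has_voiculescu_transform \<nu> \<phi> \<longleftrightarrow>
     (\<forall>z. Im z > 0 \<longrightarrow>
        z = 1 / cauchy_transform \<nu> z + \<phi> (1 / cauchy_transform \<nu> z))"

definition free_stable_phi :: "real \<Rightarrow> real \<Rightarrow> complex \<Rightarrow> complex" where
  "free_stable_phi \<alpha> \<rho> z =
     - exp (of_real pi * \<i> * of_real \<alpha> * of_real \<rho>) * z powr of_real (- \<alpha> + 1)"

definition is_free_stable :: "real \<Rightarrow> real \<Rightarrow> real measure \<Rightarrow> bool" where
  "is_free_stable \<alpha> \<rho> \<nu> \<longleftrightarrow>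
     prob_space \<nu> \<and> sets \<nu> = sets borel \<and>
     has_voiculescu_transform \<nu> (free_stable_phi \<alpha> \<rho>)"

definition is_continuous_density :: "real measure \<Rightarrow> (real \<Rightarrow> real) \<Rightarrow> bool" where
  "is_continuous_density \<nu> f \<longleftrightarrow>
     continuous_on UNIV f \<and> (\<forall>x. 0 \<le> f x) \<and> \<nu> = density lborel (\<lambda>x. ennreal (f x))"

text \<open>
  The factor common to all the series. The library function \<open>rGamma\<close> is the entire reciprocal
  of \<open>Gamma\<close>, so terms in which the argument is a non-positive integer vanish.
\<close>

definition fs_coeff :: "real \<Rightarrow> nat \<Rightarrow> real" where
  "fs_coeff c n =
     1 / pi * (-1) ^ (n - 1) * (Gamma (1 + c * real n) / fact n)
       * rGamma (2 + (c - 1) * real n)"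

definition x_star :: "real \<Rightarrow> real" where
  "x_star \<alpha> = \<alpha> * (1 - \<alpha>) powr (1 / \<alpha> - 1)"

definition y_star :: "real \<Rightarrow> real" where
  "y_star \<alpha> = 1 / \<alpha> * (1 - 1 / \<alpha>) powr (\<alpha> - 1)"

abbreviation sums_from_1 :: "(nat \<Rightarrow> real) \<Rightarrow> real \<Rightarrow> bool" where
  "sums_from_1 f s \<equiv> (\<lambda>k. f (Suc k)) sums s"

end

theory Submission
  imports Defs "HOL-Complex_Analysis.Complex_Analysis"
begin

text \<open>
  Let \<open>G\<close> be the Cauchy transform of the free stable distribution. In the upper half-plane its
  defining equation, multiplied by \<open>G(z)\<close>, reads \<open>A + B = 1\<close> with \<open>A = z * G(z)\<close> and
  \<open>B = exp (\<i> * \<pi> * \<alpha> * \<rho>) * G(z) powr \<alpha>\<close>. Since \<open>B = t * A powr \<alpha>\<close> with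
  \<open>t = exp (\<i> * \<pi> * \<alpha> * \<rho>) * z powr (- \<alpha>)\<close>, and also \<open>A = \<tau> * B powr (1 / \<alpha>)\<close> with
  \<open>\<tau> = exp (- \<i> * \<pi> * \<rho>) * z\<close>, the equation is in two ways an instance of the trinomial equation
  \<open>v + t * v powr c = 1\<close>. Its root near \<open>v = 1\<close> is, by Lagrange inversion, a power series in \<open>t\<close>
  whose coefficients are those of the theorem (\<open>fps_Lagrange_inversion\<close>, \<open>fps_inv_trinomial\<close>).

  The root is identified without any discussion of the other roots. One has \<open>z * G(z) \<longlongrightarrow> 1\<close> as
  \<open>z \<longlongrightarrow> \<i> * \<infinity>\<close>, and \<open>z * G(z) \<longlongrightarrow> 0\<close> as \<open>z \<longlongrightarrow> 0\<close> along the imaginary axis, because the measure has no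
  atom at \<open>0\<close>. Hence \<open>A\<close> is near \<open>1\<close> for large \<open>z\<close> and \<open>B\<close> is near \<open>1\<close> for small \<open>z\<close>, and in the variable
  \<open>\<zeta> = ln z\<close> the identity theorem on a half-strip extends each power series to all \<open>z\<close> for which its
  argument lies in the disc of convergence (\<open>trinomial_solution\<close>, \<open>transform_outside\<close>,
  \<open>transform_inside\<close>). The two domains are the exterior and the interior of one half-circle, whose
  radius is the critical point.

  Stieltjes inversion at a real point \<open>x > 0\<close> turns the boundary values of \<open>G\<close> into the density.
  Stirling's formula bounds the terms on the circle of convergence by a multiple of \<open>n powr (- 3/2)\<close>,
  so the series are continuous up to the critical point and the expansions hold there too, by
  continuity of the density; in the same way the point \<open>0\<close> is included. This treats all admissible
  parameters at once. The duality for \<open>\<alpha> > 1\<close> is read off from the series, and negative arguments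
  reduce to positive ones because the reflected measure is free stable with parameter \<open>1 - \<rho>\<close>.
\<close>

section \<open>Size of the coefficients\<close>

lemma Gamma_real_plus1: "x > 0 \<Longrightarrow> Gamma (x + 1) = x * Gamma (x :: real)"
  by (intro Gamma_plus1) (auto simp: nonpos_Ints_def)

text \<open>
  The error of Stirling's approximation without its additive constant. Only its boundedness on
  \<open>[1, \<infinity>)\<close> matters: it gives the order \<open>n powr (- 3/2)\<close> of the terms of the series on the circle of
  convergence.
\<close>

definition stirling_err :: "real \<Rightarrow> real" where
  "stirling_err x = ln_Gamma x - ((x - 1/2) * ln x - x)"

text \<open>
  By the functional equation of \<open>Gamma\<close> the error drops by \<open>(x + 1/2) * (ln (x + 1) - ln x) - 1\<close> from
  \<open>x\<close> to \<open>x + 1\<close>. The midpoint and the trapezoidal estimate of the integral of \<open>1/t\<close> over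
  \<open>[x, x + 1]\<close> place this drop between \<open>0\<close> and the telescoping quantity
  \<open>1 / (4 * x) - 1 / (4 * (x + 1))\<close>.
\<close>

lemma stirling_err_step:
  assumes x: "x \<ge> 1"
  shows "stirling_err (x + 1) \<le> stirling_err x"
    and "stirling_err x - 1 / (4 * x) \<le> stirling_err (x + 1) - 1 / (4 * (x + 1))"
proof -
  have "ln_Gamma (x + 1) = ln (x * Gamma x)"
    using x by (simp add: ln_Gamma_real_pos Gamma_real_plus1)
  also have "\<dots> = ln x + ln_Gamma x"
    using x Gamma_real_pos[of x] by (subst ln_mult_pos) (simp_all add: ln_Gamma_real_pos)
  finally have "ln_Gamma (x + 1) = ln x + ln_Gamma x" .
  then have eq: "stirling_err x - stirling_err (x + 1) = (x + 1/2) * (ln (x + 1) - ln x) - 1"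
    by (simp add: stirling_err_def algebra_simps)
  have "1 / (x + 1/2) \<le> ln (x + 1) - ln x"
    using ln_inverse_approx_ge[of x "x + 1"] x by (simp add: field_simps)
  then have "(x + 1/2) * (1 / (x + 1/2)) \<le> (x + 1/2) * (ln (x + 1) - ln x)"
    using x by (intro mult_left_mono) auto
  then show "stirling_err (x + 1) \<le> stirling_err x"
    using eq x by simp
  have "(x + 1/2) * (ln (x + 1) - ln x) \<le> (x + 1/2) * ((inverse x + inverse (x + 1)) / 2)"
    using x ln_inverse_approx_le[of x 1] by (intro mult_left_mono) auto
  also have "\<dots> = 1 + (1 / (4 * x) - 1 / (4 * (x + 1)))"
    using x by (simp add: divide_simps) (simp add: algebra_simps)
  finally show "stirling_err x - 1 / (4 * x) \<le> stirling_err (x + 1) - 1 / (4 * (x + 1))"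
    using eq by linarith
qed

text \<open>
  Every \<open>x \<ge> 1\<close> is reached from the compact interval \<open>[1, 2]\<close> by unit steps, along which the total
  change of the error telescopes to at most \<open>1 / 4\<close>.
\<close>

lemma stirling_err_bounded: "\<exists>K. \<forall>x\<ge>1. \<bar>stirling_err x\<bar> \<le> K"
proof -
  have "continuous_on {1..2} stirling_err"
    unfolding stirling_err_def
    by (intro continuous_intros continuous_at_imp_continuous_on ballI
          DERIV_isCont[OF has_field_derivative_ln_Gamma_real]) auto
  then have "compact (stirling_err ` {1..2})"
    by (rule compact_continuous_image) simp
  then obtain K where K: "\<And>y. y \<in> {1..2} \<Longrightarrow> \<bar>stirling_err y\<bar> \<le> K"
    by (meson bounded_real compact_imp_bounded imageI)
  have iter: "stirling_err (y + real n) \<le> stirling_err y \<and>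
        stirling_err y - 1 / (4 * y) \<le> stirling_err (y + real n) - 1 / (4 * (y + real n))"
    if "y \<ge> 1" for y n
  proof (induction n)
    case (Suc n)
    show ?case
      using Suc stirling_err_step[of "y + real n"] that by (auto simp: algebra_simps)
  qed simp
  have "\<bar>stirling_err x\<bar> \<le> K + 1" if x: "x \<ge> 1" for x
  proof -
    define n where "n = nat (\<lfloor>x\<rfloor> - 1)"
    define y where "y = x - real n"
    have "\<lfloor>x\<rfloor> \<ge> 1" using x by simp
    then have "real n = of_int \<lfloor>x\<rfloor> - 1" by (simp add: n_def)
    then have y: "y \<in> {1..2}" unfolding y_def by simp linarith
    have "stirling_err x \<le> stirling_err y"
         "stirling_err y - 1 / (4 * y) \<le> stirling_err x - 1 / (4 * x)"
      using iter[of y n] y by (auto simp: y_def)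
    moreover have "1 / (4 * y) \<le> 1" "1 / (4 * x) \<ge> 0"
      using y x by (auto simp: field_simps)
    ultimately show ?thesis using K[OF y] by linarith
  qed
  then show ?thesis by blast
qed

text \<open>
  The common radius of convergence \<open>c powr (- c) * \<bar>1 - c\<bar> powr (c - 1)\<close> of the series with parameter
  \<open>c\<close>, written through its logarithm because all later comparisons with it are comparisons of real parts
  of logarithms.
\<close>

definition fs_radius :: "real \<Rightarrow> real" where
  "fs_radius c = exp (- (c * ln c + (1 - c) * ln \<bar>1 - c\<bar>))"

lemma fs_radius_pos: "fs_radius c > 0"
  by (simp add: fs_radius_def)

lemma rGamma_reflection_bound:
  fixes x :: real
  assumes "x > 0"
  shows "\<bar>rGamma (1 - x)\<bar> \<le> Gamma x / pi"
proof -
  have "complex_of_real (rGamma x * rGamma (1 - x)) = of_real (sin (pi * x) / pi)"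
    using rGamma_reflection_complex[of "of_real x"]
    by (simp add: sin_of_real[symmetric] flip: rGamma_complex_of_real)
  then have "rGamma x * rGamma (1 - x) = sin (pi * x) / pi"
    by (simp only: of_real_eq_iff)
  then have "rGamma (1 - x) = Gamma x * (sin (pi * x) / pi)"
    using assms by (simp add: Gamma_def rGamma_eq_zero_iff nonpos_Ints_def field_simps)
  moreover have "Gamma x > 0" using assms by simp
  moreover have "\<bar>sin (pi * x) / pi\<bar> \<le> 1 / pi"
    by (simp add: divide_right_mono)
  ultimately show ?thesis
    using mult_left_mono[of "\<bar>sin (pi * x) / pi\<bar>" "1 / pi" "Gamma x"] by (simp add: abs_mult)
qed

text \<open>
  Stirling's formula applied to the three Gamma factors. The linear terms cancel because
  \<open>c * n = n + (c - 1) * n\<close>; what survives is the exponential rate \<open>fs_radius c\<close> and the power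
  \<open>n powr (- 3/2)\<close>. For \<open>c < 1\<close> the argument of \<open>rGamma\<close> tends to \<open>-\<infinity>\<close>, and the reflection formula
  turns that factor into \<open>Gamma ((1 - c) * n - 1)\<close>.
\<close>

lemma fs_coeff_bound:
  assumes c: "c > 0" "c \<noteq> 1"
  shows "\<exists>C. \<forall>\<^sub>F n in sequentially.
           \<bar>fs_coeff c n\<bar> * fs_radius c ^ n \<le> exp (C - 3/2 * ln (real n))"
proof -
  obtain K where K: "\<And>x. x \<ge> 1 \<Longrightarrow> \<bar>stirling_err x\<bar> \<le> K"
    using stirling_err_bounded by blast
  define d where "d = \<bar>1 - c\<bar>"
  have d: "d > 0" using c by (simp add: d_def)
  define L where "L = c * ln c + (1 - c) * ln d"
  define C where "C = 2 * \<bar>ln c\<bar> + 4 * \<bar>ln d\<bar> + 3 * K + ln 2"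
  \<comment> \<open>From here on all arguments of \<open>Gamma\<close> are at least \<open>1\<close>, and \<open>m = d * n\<close> satisfies \<open>m - 1 \<ge> m / 2\<close>.\<close>
  have "\<forall>\<^sub>F n in sequentially. real n \<ge> max 1 (max (2 / d) (1 / c))"
    by real_asymp
  then have "\<forall>\<^sub>F n in sequentially.
           \<bar>fs_coeff c n\<bar> * fs_radius c ^ n \<le> exp (C - 3/2 * ln (real n))"
  proof eventually_elim
    case (elim n)
    then have n: "real n \<ge> 1" and dn: "d * n \<ge> 2" and cn: "c * n \<ge> 1"
      using c d by (auto simp: field_simps)
    define m where "m = d * n"
    have ln_cn: "ln (c * n) = ln c + ln n" and ln_m: "ln m = ln d + ln n"
      using c d n by (simp_all add: ln_mult m_def)
    have G: "\<bar>ln_Gamma x - ((x - 1/2) * ln x - x)\<bar> \<le> K" if "x \<ge> 1" for x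
      using K[OF that] by (simp add: stirling_err_def)
    have Gcn: "ln_Gamma (c * n) \<le> (c * n - 1/2) * (ln c + ln n) - c * n + K"
      using G[of "c * n"] cn by (simp add: ln_cn)
    have Gn: "ln_Gamma n \<ge> (n - 1/2) * ln n - n - K"
      using G[of n] n by simp
    have Gm: "\<bar>ln_Gamma m - ((m - 1/2) * (ln d + ln n) - m)\<bar> \<le> K"
      using G[of m] dn by (simp add: ln_m m_def[symmetric])
    have pos: "m > 0" "c * n > 0" "real n > 0" using dn cn n by (auto simp: m_def)
    have expG: "Gamma x = exp (ln_Gamma x)" if "x > 0" for x :: real
      using that by (rule Gamma_real_pos_exp)
    have fact_n: "fact n = real n * Gamma (real n)"
    proof -
      have "Gamma (real n + 1) = real n * Gamma (real n)"
        using pos by (intro Gamma_real_plus1)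
      then show ?thesis using Gamma_fact[of n, where ?'a = real] by (simp add: add.commute)
    qed
    have num: "Gamma (1 + c * n) = c * n * Gamma (c * n)"
      using Gamma_real_plus1[of "c * n"] pos by (simp add: add.commute)
    have radius: "fs_radius c ^ n = exp (- (n * L))"
      by (simp add: fs_radius_def L_def d_def exp_of_nat_mult[symmetric] algebra_simps)
    have abs_coeff: "\<bar>fs_coeff c n\<bar> = c / pi * (Gamma (c * n) / Gamma n * \<bar>rGamma (2 + (c - 1) * n)\<bar>)"
      using pos c by (simp add: fs_coeff_def abs_mult fact_n num)
    have ratio: "Gamma (c * n) / Gamma n = exp (ln_Gamma (c * n) - ln_Gamma n)"
      using pos by (simp add: expG exp_diff)
    have "c / pi = exp (ln c - ln pi)" using c by (simp add: exp_diff)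
    moreover have "ln pi > 0" using pi_gt3 by (intro ln_gt_zero) simp
    then have "ln c - ln pi \<le> \<bar>ln c\<bar>" by linarith
    ultimately have cpi: "c / pi \<le> exp \<bar>ln c\<bar>"
      by simp
    have ln_abs: "- ln c \<le> \<bar>ln c\<bar>" "- ln d \<le> \<bar>ln d\<bar>" "ln (2::real) > 0"
        "\<bar>ln c\<bar> \<ge> 0" "\<bar>ln d\<bar> \<ge> 0"
      by auto
    have "\<bar>rGamma (2 + (c - 1) * n)\<bar> * exp (ln_Gamma (c * n) - ln_Gamma n)
            \<le> exp (C - \<bar>ln c\<bar> - 3/2 * ln n + n * L)"
    proof (cases "c > 1")
      case True
      then have dc: "d = c - 1" by (simp add: d_def)
      have Gm2: "Gamma (2 + m) = (1 + m) * (m * Gamma m)"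
        using Gamma_real_plus1[of "m + 1"] Gamma_real_plus1[of m] pos by (simp add: add_ac)
      have "m * Gamma m * m \<le> Gamma (2 + m)"
        unfolding Gm2 using pos by (simp add: algebra_simps)
      moreover have "m * Gamma m * m = exp (2 * ln m + ln_Gamma m)"
        using pos by (simp add: exp_add expG exp_double power2_eq_square)
      ultimately have "1 / Gamma (2 + m) \<le> 1 / exp (2 * ln m + ln_Gamma m)"
        using pos by (intro divide_left_mono) auto
      then have "\<bar>rGamma (2 + m)\<bar> \<le> exp (- (2 * ln m + ln_Gamma m))"
        unfolding exp_minus inverse_eq_divide rGamma_inverse_Gamma using pos by simp
      then have "\<bar>rGamma (2 + m)\<bar> * exp (ln_Gamma (c * n) - ln_Gamma n)
           \<le> exp (- (2 * ln m + ln_Gamma m)) * exp (ln_Gamma (c * n) - ln_Gamma n)"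
        by (intro mult_right_mono) auto
      also have "\<dots> = exp (ln_Gamma (c * n) - ln_Gamma n - ln_Gamma m - 2 * ln d - 2 * ln n)"
        by (simp add: ln_m flip: exp_add)
      also have "\<dots> \<le> exp (C - \<bar>ln c\<bar> - 3/2 * ln n + n * L)"
      proof -
        have "ln_Gamma (c * n) - ln_Gamma n - ln_Gamma m
          \<le> (c * n - 1/2) * (ln c + ln n) - c * n - ((n - 1/2) * ln n - n)
              - ((m - 1/2) * (ln d + ln n) - m) + 3 * K"
          using Gcn Gn Gm by linarith
        also have "\<dots> = n * L + 1/2 * ln n - 1/2 * ln c + 1/2 * ln d + 3 * K"
          by (simp add: m_def dc L_def algebra_simps)
        finally have "ln_Gamma (c * n) - ln_Gamma n - ln_Gamma m - 2 * ln d - 2 * ln n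
            \<le> C - \<bar>ln c\<bar> - 3/2 * ln n + n * L"
          using ln_abs unfolding C_def by linarith
        then show ?thesis by simp
      qed
      finally show ?thesis by (simp add: m_def dc)
    next
      case False
      then have dc: "d = 1 - c" by (simp add: d_def)
      have arg: "2 + (c - 1) * n = 1 - (m - 1)"
        by (simp add: m_def dc algebra_simps)
      have m2: "m \<ge> 2" using dn by (simp add: m_def)
      have "(m - 1) * Gamma (m - 1) = Gamma m"
        using Gamma_real_plus1[of "m - 1"] m2 by simp
      moreover have "m / 2 * Gamma (m - 1) \<le> (m - 1) * Gamma (m - 1)"
        using m2 by (intro mult_right_mono) auto
      ultimately have "Gamma (m - 1) \<le> 2 * Gamma m / m"
        using m2 by (simp add: field_simps)
      also have "\<dots> = exp (ln 2 + ln_Gamma m - ln m)"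
        using pos by (simp add: exp_add exp_diff expG)
      finally have Gm1: "Gamma (m - 1) \<le> exp (ln 2 + ln_Gamma m - ln m)" .
      have "Gamma (m - 1) / pi \<le> Gamma (m - 1)"
        using m2 pi_gt3 by (simp add: field_simps)
      then have "\<bar>rGamma (2 + (c - 1) * n)\<bar> \<le> exp (ln 2 + ln_Gamma m - ln m)"
        unfolding arg using rGamma_reflection_bound[of "m - 1"] m2 Gm1 by linarith
      then have "\<bar>rGamma (2 + (c - 1) * n)\<bar> * exp (ln_Gamma (c * n) - ln_Gamma n)
           \<le> exp (ln 2 + ln_Gamma m - ln m) * exp (ln_Gamma (c * n) - ln_Gamma n)"
        by (intro mult_right_mono) auto
      also have "\<dots> = exp (ln_Gamma (c * n) - ln_Gamma n + ln_Gamma m + ln 2 - ln d - ln n)"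
        by (simp add: ln_m algebra_simps flip: exp_add)
      also have "\<dots> \<le> exp (C - \<bar>ln c\<bar> - 3/2 * ln n + n * L)"
      proof -
        have "ln_Gamma (c * n) - ln_Gamma n + ln_Gamma m
          \<le> (c * n - 1/2) * (ln c + ln n) - c * n - ((n - 1/2) * ln n - n)
              + ((m - 1/2) * (ln d + ln n) - m) + 3 * K"
          using Gcn Gn Gm by linarith
        also have "\<dots> = n * L - 1/2 * ln n - 1/2 * ln c - 1/2 * ln d + 3 * K"
          by (simp add: m_def dc L_def algebra_simps)
        finally have "ln_Gamma (c * n) - ln_Gamma n + ln_Gamma m + ln 2 - ln d - ln n
            \<le> C - \<bar>ln c\<bar> - 3/2 * ln n + n * L"
          using ln_abs unfolding C_def by linarith
        then show ?thesis by simp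
      qed
      finally show ?thesis .
    qed
    then have "c / pi * (Gamma (c * n) / Gamma n * \<bar>rGamma (2 + (c - 1) * n)\<bar>)
        \<le> exp \<bar>ln c\<bar> * exp (C - \<bar>ln c\<bar> - 3/2 * ln n + n * L)"
      unfolding ratio using cpi by (intro mult_mono) (simp_all add: mult.commute)
    then have "\<bar>fs_coeff c n\<bar> * fs_radius c ^ n
        \<le> exp \<bar>ln c\<bar> * exp (C - \<bar>ln c\<bar> - 3/2 * ln n + n * L) * exp (- (n * L))"
      unfolding abs_coeff radius by (intro mult_right_mono) auto
    also have "\<dots> = exp (C - 3/2 * ln n)"
      by (simp flip: exp_add)
    finally show ?case .
  qed
  then show ?thesis by blast
qed

text \<open>
  The series converges absolutely even on the boundary circle; this is what lets the two expansions
  of the density meet at the critical point.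
\<close>

lemma summable_fs_coeff:
  assumes c: "c > 0" "c \<noteq> 1"
  shows "summable (\<lambda>k. \<bar>fs_coeff c (Suc k)\<bar> * fs_radius c ^ k)"
proof -
  obtain C where C: "\<forall>\<^sub>F n in sequentially.
           \<bar>fs_coeff c n\<bar> * fs_radius c ^ n \<le> exp (C - 3/2 * ln (real n))"
    using fs_coeff_bound[OF c] by blast
  have "summable (\<lambda>n. exp C * real n powr (- 3/2))"
    by (intro summable_mult) (simp add: summable_real_powr_iff)
  moreover have "\<forall>\<^sub>F n in sequentially.
      norm (\<bar>fs_coeff c n\<bar> * fs_radius c ^ n) \<le> exp C * real n powr (- 3/2)"
    using C eventually_gt_at_top[of 0]
  proof eventually_elim
    case (elim n)
    have "exp (C - 3/2 * ln (real n)) = exp C * real n powr (- 3/2)"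
      using elim(2) by (simp add: powr_def flip: exp_add)
    then show ?case
      using elim(1) by (simp add: abs_mult fs_radius_pos less_imp_le)
  qed
  ultimately have "summable (\<lambda>n. \<bar>fs_coeff c n\<bar> * fs_radius c ^ n)"
    by (rule summable_comparison_test_ev[rotated])
  then have "summable (\<lambda>k. \<bar>fs_coeff c (Suc k)\<bar> * fs_radius c ^ (Suc k))"
    by (subst summable_Suc_iff)
  then have "summable (\<lambda>k. inverse (fs_radius c) * (\<bar>fs_coeff c (Suc k)\<bar> * fs_radius c ^ (Suc k)))"
    by (rule summable_mult)
  then show ?thesis
    using fs_radius_pos[of c] by (simp add: field_simps)
qed

section \<open>Lagrange inversion for the trinomial equation\<close>

text \<open>
  Let \<open>f = X / \<phi>\<close> and let \<open>D\<close> be the derivative of its compositional inverse. The chain rule gives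
  \<open>D(f) * f' = 1\<close>, hence \<open>\<phi> ^ n = (\<Sum>k. D\<^sub>k * \<phi> ^ n * f' * f ^ k)\<close>. In degree \<open>n - 1\<close> every summand with
  \<open>k \<noteq> n - 1\<close> vanishes, because up to a power of \<open>X\<close> it is \<open>\<phi> ^ m - X * (\<phi> ^ m)' / m\<close> with
  \<open>m = n - 1 - k\<close>, whose coefficient of degree \<open>m\<close> is zero. This is the residue argument for Lagrange
  inversion without negative powers.
\<close>

lemma fps_Lagrange_inversion:
  fixes \<phi> :: "'a::field_char_0 fps"
  assumes \<phi>0: "fps_nth \<phi> 0 \<noteq> 0" and n: "n > 0"
  shows "of_nat n * fps_nth (fps_inv (fps_X * inverse \<phi>)) n = fps_nth (\<phi> ^ n) (n - 1)"
proof -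
  define f where "f = fps_X * inverse \<phi>"
  define D where "D = fps_deriv (fps_inv f)"
  have inv: "\<phi> * inverse \<phi> = 1"
    using \<phi>0 by (simp add: inverse_mult_eq_1')
  have f0: "fps_nth f 0 = 0" and f1: "fps_nth f 1 \<noteq> 0"
    using \<phi>0 by (simp_all add: f_def)
  have "fps_inv f oo f = fps_X"
    using f0 f1 by (rule fps_inv)
  then have "fps_deriv (fps_inv f oo f) = 1"
    by simp
  then have chain: "fps_deriv f * (D oo f) = 1"
    using f0 by (simp add: fps_compose_deriv D_def mult.commute)
  have \<phi>f: "\<phi> * f = fps_X"
    by (simp add: f_def inv mult.left_commute)
  have f': "\<phi> * fps_deriv f = 1 - f * fps_deriv \<phi>"
  proof -
    have "fps_deriv (\<phi> * f) = 1" by (simp add: \<phi>f)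
    then show ?thesis by (simp add: algebra_simps)
  qed
  have coeff_term: "fps_nth (\<phi> ^ n * fps_deriv f * f ^ k) (n - 1) = (if k = n - 1 then 1 else 0)"
    if k: "k < n" for k
  proof -
    define m where "m = n - k - 1"
    have nk: "n = Suc (m + k)" using k by (simp add: m_def)
    have "\<phi> ^ n * fps_deriv f * f ^ k = (\<phi> * f) ^ k * (\<phi> ^ m * (\<phi> * fps_deriv f))"
      by (simp add: nk power_add power_mult_distrib mult_ac)
    also have "\<dots> = fps_X ^ k * (\<phi> ^ m - f * \<phi> ^ m * fps_deriv \<phi>)"
      by (simp add: \<phi>f f' algebra_simps)
    finally have "fps_nth (\<phi> ^ n * fps_deriv f * f ^ k) (n - 1)
                    = fps_nth (\<phi> ^ m - f * \<phi> ^ m * fps_deriv \<phi>) m"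
      by (simp add: nk fps_X_power_mult_nth)
    also have "\<dots> = (if m = 0 then 1 else 0)"
    proof (cases m)
      case 0
      then show ?thesis using f0 by simp
    next
      case (Suc j)
      have "f * \<phi> ^ m * fps_deriv \<phi> = (\<phi> * f) * (\<phi> ^ j * fps_deriv \<phi>)"
        by (simp add: Suc mult_ac)
      then have shift: "f * \<phi> ^ m * fps_deriv \<phi> = fps_X * (\<phi> ^ j * fps_deriv \<phi>)"
        by (simp only: \<phi>f)
      have "fps_deriv (\<phi> ^ m) = of_nat m * (\<phi> ^ j * fps_deriv \<phi>)"
        unfolding fps_deriv_power' by (simp add: Suc mult_ac)
      then have "of_nat m * fps_nth (\<phi> ^ j * fps_deriv \<phi>) j = fps_nth (fps_deriv (\<phi> ^ m)) j"
        by (simp flip: fps_of_nat)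
      then have "of_nat m * fps_nth (\<phi> ^ j * fps_deriv \<phi>) j = of_nat m * fps_nth (\<phi> ^ m) m"
        unfolding fps_deriv_nth using Suc by simp
      then have "fps_nth (\<phi> ^ j * fps_deriv \<phi>) j = fps_nth (\<phi> ^ m) m"
        using Suc by (metis mult_cancel_left of_nat_neq_0)
      then show ?thesis unfolding fps_sub_nth shift fps_X_mult_nth using Suc by simp
    qed
    also have "m = 0 \<longleftrightarrow> k = n - 1" using k by (auto simp: m_def)
    finally show ?thesis .
  qed
  have comp: "fps_nth (D oo f) j = fps_nth (\<Sum>k<n. fps_const (fps_nth D k) * f ^ k) j" if "j < n" for j
  proof -
    have "fps_nth (D oo f) j = (\<Sum>i=0..j. fps_nth D i * fps_nth (f ^ i) j)"
      by (rule fps_compose_nth)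
    also have "\<dots> = (\<Sum>i<n. fps_nth D i * fps_nth (f ^ i) j)"
    proof (rule sum.mono_neutral_left)
      show "\<forall>i\<in>{..<n} - {0..j}. fps_nth D i * fps_nth (f ^ i) j = 0"
        using f0 by (auto simp: startsby_zero_power_prefix)
    qed (use that in auto)
    finally show ?thesis by (simp add: fps_sum_nth)
  qed
  have "fps_nth (\<phi> ^ n) (n - 1) = fps_nth (\<phi> ^ n * fps_deriv f * (D oo f)) (n - 1)"
    by (simp add: mult.assoc chain)
  also have "\<dots> = fps_nth (\<phi> ^ n * fps_deriv f * (\<Sum>k<n. fps_const (fps_nth D k) * f ^ k)) (n - 1)"
    unfolding fps_mult_nth[of "\<phi> ^ n * fps_deriv f"]
    using comp n by (intro sum.cong) auto
  also have "\<dots> = (\<Sum>k<n. fps_nth D k * fps_nth (\<phi> ^ n * fps_deriv f * f ^ k) (n - 1))"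
    by (simp add: sum_distrib_left fps_sum_nth mult.left_commute)
  also have "\<dots> = (\<Sum>k<n. if k = n - 1 then fps_nth D k else 0)"
    using coeff_term by (intro sum.cong) simp_all
  also have "\<dots> = fps_nth D (n - 1)"
    using n by simp
  also have "\<dots> = of_nat n * fps_nth (fps_inv f) n"
    using n by (simp add: D_def)
  finally show ?thesis by (simp add: f_def)
qed

lemma gbinomial_eq_Gamma:
  fixes a :: real
  assumes "a > -1"
  shows "fact k * (a gchoose k) = Gamma (1 + a) * rGamma (a - real k + 1)"
proof -
  have "a + 1 \<notin> \<int>\<^sub>\<le>\<^sub>0" using assms by (auto simp: nonpos_Ints_def)
  then have "Gamma (1 + a) * rGamma (a + 1) = 1"
    by (simp add: Gamma_def rGamma_eq_zero_iff add.commute)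
  moreover have "rGamma (a - real k + 1) = pochhammer (a - real k + 1) k * rGamma (a + 1)"
    using pochhammer_rGamma[of "a - real k + 1" k] by simp
  ultimately show ?thesis
    by (simp add: gbinomial_pochhammer')
qed

text \<open>
  The coefficients in the form in which Lagrange inversion produces them.
\<close>

lemma fs_coeff_eq_gbinomial:
  assumes "c > 0"
  shows "real (Suc k) * (pi * fs_coeff c (Suc k)) = (-1) ^ k * ((c * real (Suc k)) gchoose k)"
proof -
  have arg: "2 + (c - 1) * real (Suc k) = c * real (Suc k) - real k + 1"
    by (simp add: algebra_simps)
  have "real (Suc k) * (pi * fs_coeff c (Suc k))
     = (-1) ^ k * (real (Suc k) / fact (Suc k)) * (Gamma (1 + c * real (Suc k)) * rGamma (c * real (Suc k) - real k + 1))"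
    unfolding fs_coeff_def arg by simp
  also have "real (Suc k) / fact (Suc k) = 1 / fact k" by simp
  also have "Gamma (1 + c * real (Suc k)) * rGamma (c * real (Suc k) - real k + 1)
               = fact k * ((c * real (Suc k)) gchoose k)"
  proof -
    have "0 < c * real (Suc k)" using assms by simp
    then show ?thesis using gbinomial_eq_Gamma[of "c * real (Suc k)" k] by linarith
  qed
  finally show ?thesis by simp
qed

lemma gbinomial_of_real: "of_real (a gchoose k) = (of_real a :: complex) gchoose k"
  by (simp add: gbinomial_prod_rev)

text \<open>
  The exponent \<open>k\<close> carries the coefficient of index \<open>k + 1\<close>: the series of the densities start at
  index \<open>1\<close> with the zeroth power.
\<close>

definition fs_fps :: "real \<Rightarrow> complex fps" where
  "fs_fps c = Abs_fps (\<lambda>k. of_real (fs_coeff c (Suc k)))"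

text \<open>
  If \<open>v = 1 + s\<close> solves \<open>v + t * v powr c = 1\<close>, then \<open>t = - s * (1 + s) powr (- c)\<close>. Lagrange inversion
  with \<open>\<phi> = - (1 + s) powr c\<close> expresses \<open>s\<close> as a power series in \<open>t\<close>.
\<close>

lemma fps_inv_trinomial:
  assumes "c > 0"
  shows "fps_inv (- fps_X * fps_binomial (- of_real c)) = - fps_const (of_real pi) * fps_X * fs_fps c"
proof -
  define \<phi> :: "complex fps" where "\<phi> = - fps_binomial (of_real c)"
  have "fps_binomial (of_real c) * fps_binomial (- of_real c :: complex) = 1"
    by (simp flip: fps_binomial_add_mult)
  then have "inverse \<phi> = - fps_binomial (- of_real c)"
    by (simp add: \<phi>_def fps_inverse_unique)
  then have f: "- fps_X * fps_binomial (- of_real c) = fps_X * inverse \<phi>"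
    by simp
  show ?thesis
  proof (rule fps_ext)
    fix n
    show "fps_nth (fps_inv (- fps_X * fps_binomial (- of_real c))) n
            = fps_nth (- fps_const (of_real pi) * fps_X * fs_fps c) n"
    proof (cases n)
      case 0
      then show ?thesis by (simp add: fps_inv_def)
    next
      case (Suc k)
      have "of_nat n * fps_nth (fps_inv (fps_X * inverse \<phi>)) n = fps_nth (\<phi> ^ n) k"
        using fps_Lagrange_inversion[of \<phi> n] by (simp add: \<phi>_def Suc)
      also have "\<phi> ^ n = (-1) ^ n * fps_binomial (of_nat n * of_real c)"
        unfolding \<phi>_def by (subst power_minus) (simp only: fps_binomial_power)
      also have "fps_nth \<dots> k = (-1) ^ n * ((of_nat n * of_real c) gchoose k)"
        by (cases "even n") simp_all
      also have "\<dots> = - of_real ((-1) ^ k * ((c * real n) gchoose k))"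
        by (simp add: Suc gbinomial_of_real mult.commute)
      also have "\<dots> = - of_real (real n * (pi * fs_coeff c n))"
        using fs_coeff_eq_gbinomial[OF assms, of k] by (simp add: Suc)
      also have "\<dots> = of_nat n * (- of_real pi * of_real (fs_coeff c n))"
        by simp
      finally have "fps_nth (fps_inv (fps_X * inverse \<phi>)) n = - of_real pi * of_real (fs_coeff c n)"
        using Suc by (metis mult_cancel_left of_nat_neq_0)
      then show ?thesis
        unfolding f by (simp add: Suc fs_fps_def mult.assoc)
    qed
  qed
qed

text \<open>
  The formal inversion becomes an identity of analytic functions near \<open>1\<close>, for any root of
  \<open>v + t * v powr c = 1\<close> close to \<open>1\<close>. Both \<open>v = exp l\<close> and \<open>t = exp s\<close> are given by logarithms, so that
  \<open>v powr c\<close> is the holomorphic expression \<open>exp (c * l)\<close> and no branch has to be chosen.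
\<close>

lemma trinomial_solution_near_1:
  assumes c: "c > 0" and conv: "fps_conv_radius (fs_fps c) > 0"
  shows "eventually (\<lambda>l. \<forall>s. exp l + exp (s + of_real c * l) = 1 \<longrightarrow>
             exp (of_real c * l) = of_real pi * eval_fps (fs_fps c) (exp s)) (nhds 0)"
proof -
  define f where "f = (\<lambda>s::complex. - s * (1 + s) powr (- of_real c))"
  define F :: "complex fps" where "F = - fps_X * fps_binomial (- of_real c)"
  define h where "h = (\<lambda>t. - of_real pi * t * eval_fps (fs_fps c) t)"
  have f: "f has_fps_expansion F"
    unfolding f_def F_def by (intro fps_expansion_intros)
  have h: "h has_fps_expansion fps_inv F"
    unfolding h_def F_def fps_inv_trinomial[OF c] fps_const_neg[symmetric]
    by (intro fps_expansion_intros eval_fps_has_fps_expansion conv)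
  have F0: "fps_nth F 0 = 0" and F1: "fps_nth F 1 \<noteq> 0"
    by (simp_all add: F_def)
  have "(h \<circ> f) has_fps_expansion (fps_inv F oo F)"
    using h f F0 by (rule has_fps_expansion_compose)
  then have "(h \<circ> f) has_fps_expansion fps_X"
    by (simp add: fps_inv[OF F0 F1])
  then have "eventually (\<lambda>s. eval_fps fps_X s = (h \<circ> f) s) (nhds 0)"
    by (simp add: has_fps_expansion_def)
  then have ev: "eventually (\<lambda>s. h (f s) = s) (nhds 0)"
    by (simp add: eq_commute)
  have "filterlim (\<lambda>l::complex. exp l - 1) (nhds 0) (nhds 0)"
    by (auto intro!: tendsto_eq_intros filterlim_ident)
  from eventually_compose_filterlim[OF ev this]
  have ev1: "eventually (\<lambda>l. h (f (exp l - 1)) = exp l - 1) (nhds 0)" .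
  have ev2: "eventually (\<lambda>l::complex. l \<in> ball 0 pi) (nhds 0)"
    by (rule eventually_nhds_in_open) auto
  from ev1 ev2 show ?thesis
  proof eventually_elim
    case (elim l)
    have "\<bar>Im l\<bar> < pi"
      using elim(2) abs_Im_le_cmod[of l] by simp
    then have Ln: "Ln (exp l) = l" by (intro Ln_exp) auto
    have f: "f (exp l - 1) = (1 - exp l) * exp (- of_real c * l)"
      by (simp add: f_def powr_def Ln algebra_simps)
    show ?case
    proof (intro allI impI)
      fix s assume eq: "exp l + exp (s + of_real c * l) = 1"
      then have *: "1 - exp l = exp s * exp (of_real c * l)"
        by (simp add: exp_add algebra_simps)
      then have "f (exp l - 1) = exp s"
        unfolding f by (simp add: exp_minus)
      with elim(1) have "- (of_real pi * exp s * eval_fps (fs_fps c) (exp s)) = exp l - 1"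
        by (simp add: h_def)
      then have "exp s * exp (of_real c * l) = exp s * (of_real pi * eval_fps (fs_fps c) (exp s))"
        unfolding *[symmetric] by (simp add: algebra_simps)
      then show "exp (of_real c * l) = of_real pi * eval_fps (fs_fps c) (exp s)"
        by simp
    qed
  qed
qed

section \<open>Cauchy transform and Stieltjes inversion\<close>

context
  fixes \<nu> :: "real measure"
  assumes prob: "prob_space \<nu>" and sets_eq [measurable_cong]: "sets \<nu> = sets borel"
begin

interpretation prob_space \<nu> by (fact prob)

lemma norm_Cauchy_kernel_le:
  assumes "Im z > 0"
  shows "z - of_real x \<noteq> 0" "norm (1 / (z - of_real x)) \<le> 1 / Im z"
proof -
  have le: "Im z \<le> norm (z - of_real x)"
    using abs_Im_le_cmod[of "z - of_real x"] assms by simp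
  then show "z - of_real x \<noteq> 0" using assms by auto
  show "norm (1 / (z - of_real x)) \<le> 1 / Im z"
    using le assms by (simp add: norm_divide frac_le)
qed

lemma integrable_Cauchy_kernel:
  assumes "Im z > 0"
  shows "integrable \<nu> (\<lambda>x. 1 / (z - of_real x))"
  by (rule integrable_const_bound[where B = "1 / Im z"])
     (use assms norm_Cauchy_kernel_le in auto)

lemma Im_cauchy_transform:
  assumes "Im z > 0"
  shows "Im (cauchy_transform \<nu> z) = (\<integral>x. Im (1 / (z - of_real x)) \<partial>\<nu>)"
  unfolding cauchy_transform_def by (rule integral_Im[symmetric]) (rule integrable_Cauchy_kernel[OF assms])

lemma Im_cauchy_transform_neg:
  assumes z: "Im z > 0"
  shows "Im (cauchy_transform \<nu> z) < 0"
  unfolding Im_cauchy_transform[OF z]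
proof (rule expectation_less)
  show "integrable \<nu> (\<lambda>x. Im (1 / (z - of_real x)))"
    by (intro integrable_Im integrable_Cauchy_kernel z)
  have "Im (1 / (z - of_real x)) < 0" for x
  proof -
    have "(Re z - x)\<^sup>2 + (Im z)\<^sup>2 > 0" using z by (simp add: add_nonneg_pos)
    then show ?thesis using z by (simp add: Im_divide)
  qed
  then show "AE x in \<nu>. Im (1 / (z - of_real x)) < 0" by simp
qed

text \<open>
  Differentiation under the integral. The difference quotient of the kernel differs from
  \<open>- 1 / (z - x)\<^sup>2\<close> by \<open>h / ((z + h - x) * (z - x)\<^sup>2)\<close>, which is uniformly small in \<open>x\<close> because \<open>z\<close> keeps a
  positive distance from the real axis.
\<close>

lemma has_field_derivative_cauchy_transform:
  assumes z: "Im z > 0"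
  shows "(cauchy_transform \<nu> has_field_derivative - (\<integral>x. 1 / (z - of_real x)\<^sup>2 \<partial>\<nu>)) (at z)"
  unfolding DERIV_def
proof (rule LIM_zero_cancel, rule Lim_null_comparison)
  define d where "d = Im z"
  have d: "d > 0" using z by (simp add: d_def)
  have "\<forall>\<^sub>F h in at 0. h \<in> ball 0 (d/2) - {0::complex}"
    using d by (intro eventually_at_in_open) auto
  then show "\<forall>\<^sub>F h in at 0. norm ((cauchy_transform \<nu> (z + h) - cauchy_transform \<nu> z) / h
                 - - (\<integral>x. 1 / (z - of_real x)\<^sup>2 \<partial>\<nu>)) \<le> norm h * (2 / d ^ 3)"
  proof eventually_elim
    case (elim h)
    have h: "h \<noteq> 0" "norm h < d / 2" using elim by auto
    have Imzh: "Im (z + h) > d / 2"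
      using abs_Im_le_cmod[of h] h by (simp add: d_def)
    with d have zh: "Im (z + h) > 0" by linarith
    have int2: "integrable \<nu> (\<lambda>x. 1 / (z - of_real x)\<^sup>2)"
    proof (rule integrable_const_bound[where B = "(1 / d)\<^sup>2"])
      have "norm (1 / (z - of_real x)\<^sup>2) \<le> (1 / d)\<^sup>2" for x
        using power_mono[OF norm_Cauchy_kernel_le(2)[OF z, of x], of 2]
        by (simp add: norm_divide norm_power power_divide d_def)
      then show "AE x in \<nu>. norm (1 / (z - of_real x)\<^sup>2) \<le> (1 / d)\<^sup>2" by simp
    qed simp
    have "(cauchy_transform \<nu> (z + h) - cauchy_transform \<nu> z) / h - - (\<integral>x. 1 / (z - of_real x)\<^sup>2 \<partial>\<nu>)
        = (\<integral>x. (1 / (z + h - of_real x) - 1 / (z - of_real x)) / h + 1 / (z - of_real x)\<^sup>2 \<partial>\<nu>)"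
      unfolding cauchy_transform_def
      using int2 integrable_Cauchy_kernel[OF z] integrable_Cauchy_kernel[OF zh] h
      by (simp add: Bochner_Integration.integral_add Bochner_Integration.integral_diff)
    also have "\<dots> = (\<integral>x. h * (1 / (z + h - of_real x) * (1 / (z - of_real x))\<^sup>2) \<partial>\<nu>)"
    proof (rule Bochner_Integration.integral_cong)
      fix x
      have "z - of_real x \<noteq> 0" "z + h - of_real x \<noteq> 0"
        using norm_Cauchy_kernel_le(1)[OF z, of x] norm_Cauchy_kernel_le(1)[OF zh, of x] by auto
      then show "(1 / (z + h - of_real x) - 1 / (z - of_real x)) / h + 1 / (z - of_real x)\<^sup>2
             = h * (1 / (z + h - of_real x) * (1 / (z - of_real x))\<^sup>2)"
        using h by (simp add: divide_simps power2_eq_square) (simp add: algebra_simps)?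
    qed simp
    also have "norm \<dots> \<le> (\<integral>x. norm h * (2 / d ^ 3) \<partial>\<nu>)"
    proof (rule Bochner_Integration.integral_norm_bound_integral)
      have bound: "norm (h * (1 / (z + h - of_real x) * (1 / (z - of_real x))\<^sup>2)) \<le> norm h * (2 / d ^ 3)" for x
      proof -
        have "norm (1 / (z + h - of_real x)) \<le> 1 / Im (z + h)"
          by (rule norm_Cauchy_kernel_le[OF zh])
        also have "\<dots> \<le> 2 / d" using Imzh d by (simp add: field_simps)
        finally have "norm (1 / (z + h - of_real x)) * norm (1 / (z - of_real x)) ^ 2 \<le> (2 / d) * (1 / d)\<^sup>2"
          using norm_Cauchy_kernel_le(2)[OF z, of x] d by (intro mult_mono power_mono) (auto simp: d_def)
        also have "\<dots> = 2 / d ^ 3" by (simp add: power2_eq_square power3_eq_cube)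
        finally show ?thesis
          unfolding norm_mult norm_power by (rule mult_left_mono) simp
      qed
      then show "norm (h * (1 / (z + h - of_real x) * (1 / (z - of_real x))\<^sup>2)) \<le> norm h * (2 / d ^ 3)" for x .
      show "integrable \<nu> (\<lambda>x. h * (1 / (z + h - of_real x) * (1 / (z - of_real x))\<^sup>2))"
        by (rule integrable_const_bound[where B = "norm h * (2 / d ^ 3)"]) (use bound in auto)
    qed auto
    also have "\<dots> = norm h * (2 / d ^ 3)" by (simp add: prob_space)
    finally show ?case .
  qed
  show "((\<lambda>h::complex. norm h * (2 / d ^ 3)) \<longlongrightarrow> 0) (at 0)"
    by (intro tendsto_mult_left_zero tendsto_norm_zero tendsto_ident_at)
qed

lemma holomorphic_cauchy_transform: "cauchy_transform \<nu> holomorphic_on {z. Im z > 0}"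
  using has_field_derivative_cauchy_transform
  by (intro holomorphic_onI) (auto simp: field_differentiable_def intro: has_field_derivative_at_within)

text \<open>
  On the imaginary axis the function \<open>z / (z - x)\<close> is bounded by \<open>1\<close>, so pointwise limits in \<open>x\<close> can be
  taken under the integral. The two instances that follow, at \<open>i * \<infinity>\<close> and at \<open>0\<close>, single out the
  correct branch of the trinomial equation for each of the two expansions.
\<close>

lemma tendsto_z_cauchy_transform:
  assumes y: "\<And>s. y s > 0"
    and lim: "AE x in \<nu>. ((\<lambda>s. \<i> * of_real (y s) / (\<i> * of_real (y s) - of_real x)) \<longlongrightarrow> L) at_top"
  shows "((\<lambda>s::real. \<i> * of_real (y s) * cauchy_transform \<nu> (\<i> * of_real (y s))) \<longlongrightarrow> L) at_top"
proof -
  have "((\<lambda>s. \<integral>x. \<i> * of_real (y s) / (\<i> * of_real (y s) - of_real x) \<partial>\<nu>) \<longlongrightarrow> (\<integral>x. L \<partial>\<nu>)) at_top"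
  proof (rule integral_dominated_convergence_at_top[where w = "\<lambda>_. 1"])
    have "norm (\<i> * of_real (y s) / (\<i> * of_real (y s) - of_real x)) \<le> 1" for s x
      using norm_Cauchy_kernel_le[of "\<i> * of_real (y s)" x] y[of s]
      by (simp add: norm_divide norm_mult field_simps)
    then show "\<forall>\<^sub>F s in at_top. AE x in \<nu>. norm (\<i> * of_real (y s) / (\<i> * of_real (y s) - of_real x)) \<le> 1"
      by simp
  qed (use lim in auto)
  also have "(\<lambda>s. \<integral>x. \<i> * of_real (y s) / (\<i> * of_real (y s) - of_real x) \<partial>\<nu>)
               = (\<lambda>s. \<i> * of_real (y s) * cauchy_transform \<nu> (\<i> * of_real (y s)))"
  proof
    fix s
    show "(\<integral>x. \<i> * of_real (y s) / (\<i> * of_real (y s) - of_real x) \<partial>\<nu>)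
               = \<i> * of_real (y s) * cauchy_transform \<nu> (\<i> * of_real (y s))"
      using integrable_Cauchy_kernel[of "\<i> * of_real (y s)"] y[of s]
      by (simp add: cauchy_transform_def flip: integral_mult_right_zero)
  qed
  finally show ?thesis by (simp add: prob_space)
qed

lemma z_cauchy_transform_at_i_infinity:
  "((\<lambda>s. \<i> * of_real (exp s) * cauchy_transform \<nu> (\<i> * of_real (exp s))) \<longlongrightarrow> 1) at_top"
proof (rule tendsto_z_cauchy_transform)
  have "((\<lambda>s. \<i> * of_real (exp s) / (\<i> * of_real (exp s) - of_real x)) \<longlongrightarrow> 1) at_top" for x :: real
  proof -
    have eq: "\<i> * of_real (exp s) / (\<i> * of_real (exp s) - of_real x)
                = 1 / (1 + \<i> * of_real (exp (- s) * x))" for s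
    proof -
      define w :: complex where "w = \<i> * of_real (exp s)"
      have w: "w \<noteq> 0" by (simp add: w_def)
      have "w * (\<i> * of_real (exp (- s) * x)) = - of_real (exp s * exp (- s) * x)"
        by (simp add: w_def complex_eq_iff)
      also have "exp s * exp (- s) = 1" by (simp flip: exp_add)
      finally have "w - of_real x = w * (1 + \<i> * of_real (exp (- s) * x))"
        by (simp add: distrib_left)
      with w show ?thesis unfolding w_def[symmetric] by (metis div_by_1 mult_divide_mult_cancel_left mult.right_neutral)
    qed
    have "((\<lambda>s. exp (- s) * x) \<longlongrightarrow> 0) at_top"
      by real_asymp
    then have "((\<lambda>s. 1 / (1 + \<i> * of_real (exp (- s) * x))) \<longlongrightarrow> 1 / (1 + \<i> * of_real 0)) at_top"
      by (intro tendsto_intros) auto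
    then show ?thesis unfolding eq by simp
  qed
  then show "AE x in \<nu>. ((\<lambda>s. \<i> * of_real (exp s) / (\<i> * of_real (exp s) - of_real x)) \<longlongrightarrow> 1) at_top"
    by simp
qed auto

lemma z_cauchy_transform_at_0:
  assumes "AE x in \<nu>. x \<noteq> 0"
  shows "((\<lambda>s. \<i> * of_real (exp (- s)) * cauchy_transform \<nu> (\<i> * of_real (exp (- s)))) \<longlongrightarrow> 0) at_top"
proof (rule tendsto_z_cauchy_transform)
  have "((\<lambda>s. \<i> * of_real (exp (- s)) / (\<i> * of_real (exp (- s)) - of_real x)) \<longlongrightarrow> 0) at_top"
    if "x \<noteq> 0" for x :: real
  proof -
    have "((\<lambda>s. exp (- s)) \<longlongrightarrow> 0) (at_top :: real filter)"
      by real_asymp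
    then have "((\<lambda>s. \<i> * of_real (exp (- s)) / (\<i> * of_real (exp (- s)) - of_real x))
        \<longlongrightarrow> \<i> * of_real 0 / (\<i> * of_real 0 - of_real x)) at_top"
      using that by (intro tendsto_intros) auto
    then show ?thesis by simp
  qed
  then show "AE x in \<nu>. ((\<lambda>s. \<i> * of_real (exp (- s)) / (\<i> * of_real (exp (- s)) - of_real x)) \<longlongrightarrow> 0) at_top"
    using assms by (auto elim: eventually_mono)
qed auto

end

lemma integrable_Cauchy_density: "integrable lborel (\<lambda>s::real. 1 / (1 + s\<^sup>2))"
  and integral_Cauchy_density: "(\<integral>s. 1 / (1 + s\<^sup>2) \<partial>lborel) = pi"
  using integrable_inverse_1_plus_square LBINT_inverse_1_plus_square
  by (simp_all add: set_integrable_def interval_lebesgue_integral_def set_lebesgue_integral_def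
        inverse_eq_divide)

text \<open>
  The density \<open>f\<close> may be unbounded, so it is cut at distance \<open>1\<close> from \<open>x\<close>. The near part is bounded, and
  after the substitution \<open>y = x + s / t\<close> dominated convergence applies; on the far part the kernel is
  at most \<open>1 / t\<close>.
\<close>

lemma Poisson_integral_tendsto:
  fixes f :: "real \<Rightarrow> real"
  assumes cont: "continuous_on UNIV f" and nonneg: "\<And>y. f y \<ge> 0" and int: "integrable lborel f"
  shows "((\<lambda>t. \<integral>y. (1 / t) / ((y - x)\<^sup>2 + (1 / t)\<^sup>2) * f y \<partial>lborel) \<longlongrightarrow> pi * f x) at_top"
proof -
  have [measurable]: "f \<in> borel_measurable borel"
    using cont by (rule borel_measurable_continuous_onI)
  define P where "P = (\<lambda>t y. (1 / t) / ((y - x)\<^sup>2 + (1 / t)\<^sup>2))"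
  define near where "near = (\<lambda>y. f y * indicator {x - 1..x + 1} y)"
  define far where "far = (\<lambda>y. f y * indicator (- {x - 1..x + 1}) y)"
  have [measurable]: "near \<in> borel_measurable borel" "far \<in> borel_measurable borel"
    "\<And>t. P t \<in> borel_measurable borel"
    unfolding near_def far_def P_def by measurable
  have "compact (f ` {x - 1..x + 1})"
    by (intro compact_continuous_image continuous_on_subset[OF cont]) auto
  then obtain M where M: "\<And>y. y \<in> {x - 1..x + 1} \<Longrightarrow> \<bar>f y\<bar> \<le> M"
    by (meson bounded_real compact_imp_bounded imageI)
  have M0: "M \<ge> 0" using M[of x] by simp
  have near_bound: "\<bar>near y\<bar> \<le> M" for y
    using M[of y] M0 by (auto simp: near_def indicator_def)
  have split: "f y = near y + far y" for y
    by (auto simp: near_def far_def indicator_def)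

  have lim1: "((\<lambda>t. \<integral>s. 1 / (1 + s\<^sup>2) * near (x + (1 / t) * s) \<partial>lborel) \<longlongrightarrow>
                 (\<integral>s. 1 / (1 + s\<^sup>2) * f x \<partial>lborel)) at_top"
  proof (rule integral_dominated_convergence_at_top[where w = "\<lambda>s. 1 / (1 + s\<^sup>2) * M"])
    show "integrable lborel (\<lambda>s. 1 / (1 + s\<^sup>2) * M)"
      by (intro integrable_mult_left integrable_Cauchy_density)
    have "norm (1 / (1 + s\<^sup>2) * near (x + (1 / t) * s)) \<le> 1 / (1 + s\<^sup>2) * M" for s t
      unfolding norm_mult using near_bound by (intro mult_mono) auto
    then show "\<forall>\<^sub>F t in at_top. AE s in lborel. norm (1 / (1 + s\<^sup>2) * near (x + (1 / t) * s)) \<le> 1 / (1 + s\<^sup>2) * M"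
      by simp
    have "((\<lambda>t. 1 / (1 + s\<^sup>2) * near (x + (1 / t) * s)) \<longlongrightarrow> 1 / (1 + s\<^sup>2) * f x) at_top" for s
    proof (intro tendsto_mult tendsto_const)
      have lim: "((\<lambda>t. x + (1 / t) * s) \<longlongrightarrow> x) at_top" by real_asymp
      have "isCont f x" using cont by (simp add: continuous_on_eq_continuous_at)
      then have "((\<lambda>t. f (x + (1 / t) * s)) \<longlongrightarrow> f x) at_top"
        using lim by (rule isCont_tendsto_compose)
      moreover have "\<forall>\<^sub>F t in at_top. x + (1 / t) * s \<in> {x - 1<..<x + 1}"
        using lim by (rule topological_tendstoD) auto
      then have "\<forall>\<^sub>F t in at_top. f (x + (1 / t) * s) = near (x + (1 / t) * s)"
        by eventually_elim (auto simp: near_def)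
      ultimately show "((\<lambda>t. near (x + (1 / t) * s)) \<longlongrightarrow> f x) at_top"
        by (rule Lim_transform_eventually)
    qed
    then show "AE s in lborel. ((\<lambda>t. 1 / (1 + s\<^sup>2) * near (x + (1 / t) * s)) \<longlongrightarrow> 1 / (1 + s\<^sup>2) * f x) at_top"
      by simp
  qed auto
  have near_int: "(\<integral>y. P t y * near y \<partial>lborel) = (\<integral>s. 1 / (1 + s\<^sup>2) * near (x + (1 / t) * s) \<partial>lborel)"
    if t: "t > 0" for t
  proof -
    have "(\<integral>y. P t y * near y \<partial>lborel) = \<bar>1 / t\<bar> * (\<integral>s. P t (x + (1 / t) * s) * near (x + (1 / t) * s) \<partial>lborel)"
      using t lborel_integral_real_affine[of "1 / t" "\<lambda>y. P t y * near y" x] by simp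
    also have "\<dots> = (\<integral>s. (1 / t) * (P t (x + (1 / t) * s) * near (x + (1 / t) * s)) \<partial>lborel)"
      using t by simp
    also have "(1 / t) * P t (x + (1 / t) * s) = 1 / (1 + s\<^sup>2)" for s
    proof -
      define a where "a = 1 / t"
      have "a \<noteq> 0" using t by (simp add: a_def)
      moreover have "P t (x + a * s) = a / (a\<^sup>2 * (1 + s\<^sup>2))"
        unfolding P_def a_def[symmetric] by (simp add: power_mult_distrib distrib_left add.commute)
      ultimately show ?thesis
        unfolding a_def[symmetric] by (simp add: power2_eq_square)
    qed
    then have "(\<lambda>s. (1 / t) * (P t (x + (1 / t) * s) * near (x + (1 / t) * s)))
          = (\<lambda>s. 1 / (1 + s\<^sup>2) * near (x + (1 / t) * s))"
      by (metis (no_types, lifting) mult.assoc)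
    finally show ?thesis .
  qed
  have P_bound: "0 \<le> P t y" "P t y \<le> t" if "t > 0" for t y
  proof -
    have "(y - x)\<^sup>2 + (1 / t)\<^sup>2 \<ge> (1 / t)\<^sup>2" by simp
    then have "P t y \<le> (1 / t) / (1 / t)\<^sup>2"
      unfolding P_def using that by (intro divide_left_mono) (auto intro!: mult_pos_pos add_nonneg_pos)
    also have "\<dots> = t" using that by (simp add: power2_eq_square)
    finally show "P t y \<le> t" .
  qed (use that in \<open>simp add: P_def\<close>)
  have P_far: "P t y \<le> 1 / t" if "t > 0" "y \<notin> {x - 1..x + 1}" for t y
  proof -
    have "1 \<le> \<bar>y - x\<bar>" using that by auto
    then have "1 \<le> (y - x)\<^sup>2" using power_mono[of 1 "\<bar>y - x\<bar>" 2] by simp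
    then have "1 \<le> (y - x)\<^sup>2 + (1 / t)\<^sup>2" using zero_le_power2[of "1 / t"] by linarith
    then have "P t y \<le> (1 / t) / 1"
      unfolding P_def using that by (intro divide_left_mono) auto
    then show ?thesis by simp
  qed
  have int_near: "integrable lborel (\<lambda>y. P t y * near y)" and int_far: "integrable lborel (\<lambda>y. P t y * far y)"
    if "t > 0" for t
  proof -
    have *: "\<bar>P t y * near y\<bar> \<le> t * f y" "\<bar>P t y * far y\<bar> \<le> t * f y" for y
      using P_bound[OF that, of y] nonneg[of y] that
      by (auto simp: near_def far_def indicator_def abs_mult intro!: mult_right_mono)
    have "integrable lborel (\<lambda>y. t * f y)" using int by simp
    then show "integrable lborel (\<lambda>y. P t y * near y)" "integrable lborel (\<lambda>y. P t y * far y)"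
      by (rule Bochner_Integration.integrable_bound; use * nonneg that in \<open>simp add: abs_mult\<close>)+
  qed
  have lim2: "((\<lambda>t. \<integral>y. P t y * far y \<partial>lborel) \<longlongrightarrow> 0) at_top"
  proof (rule Lim_null_comparison)
    show "\<forall>\<^sub>F t in at_top. norm (\<integral>y. P t y * far y \<partial>lborel) \<le> (1 / t) * (\<integral>y. f y \<partial>lborel)"
      using eventually_gt_at_top[of 0]
    proof eventually_elim
      case (elim t)
      have "norm (P t y * far y) \<le> (1 / t) * f y" for y
        using mult_right_mono[OF P_far[OF elim, of y] nonneg[of y]] P_bound[OF elim, of y] nonneg[of y] elim
        by (auto simp: far_def indicator_def abs_mult)
      then have "norm (\<integral>y. P t y * far y \<partial>lborel) \<le> (\<integral>y. (1 / t) * f y \<partial>lborel)"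
        using int int_far[OF elim] by (intro Bochner_Integration.integral_norm_bound_integral) auto
      then show ?case by simp
    qed
    show "((\<lambda>t. (1 / t) * (\<integral>y. f y \<partial>lborel)) \<longlongrightarrow> 0) at_top"
      by (rule tendsto_mult_left_zero) real_asymp
  qed
  have "((\<lambda>t. (\<integral>s. 1 / (1 + s\<^sup>2) * near (x + (1 / t) * s) \<partial>lborel) + (\<integral>y. P t y * far y \<partial>lborel))
          \<longlongrightarrow> (\<integral>s. 1 / (1 + s\<^sup>2) * f x \<partial>lborel) + 0) at_top"
    by (intro tendsto_add lim1 lim2)
  moreover have "\<forall>\<^sub>F t in at_top. (\<integral>s. 1 / (1 + s\<^sup>2) * near (x + (1 / t) * s) \<partial>lborel) + (\<integral>y. P t y * far y \<partial>lborel)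
      = (\<integral>y. P t y * f y \<partial>lborel)"
    using eventually_gt_at_top[of 0]
  proof eventually_elim
    case (elim t)
    show ?case
      unfolding near_int[OF elim, symmetric] split distrib_left
      using int_near[OF elim] int_far[OF elim] by (rule Bochner_Integration.integral_add[symmetric])
  qed
  ultimately have "((\<lambda>t. \<integral>y. P t y * f y \<partial>lborel) \<longlongrightarrow> (\<integral>s. 1 / (1 + s\<^sup>2) * f x \<partial>lborel) + 0) at_top"
    by (rule Lim_transform_eventually)
  then show ?thesis
    by (simp only: P_def integral_mult_left_zero integral_Cauchy_density add_0_right)
qed

text \<open>
  The imaginary part of the Cauchy transform at height \<open>1 / t\<close> is, up to sign, the Poisson integral of
  the density.
\<close>

lemma Stieltjes_inversion:
  assumes prob: "prob_space \<nu>" and dens: "is_continuous_density \<nu> f"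
    and lim: "((\<lambda>t. cauchy_transform \<nu> (of_real x + \<i> * of_real (1 / t))) \<longlongrightarrow> L) at_top"
  shows "f x = - Im L / pi"
proof -
  have cont: "continuous_on UNIV f" and nonneg: "\<And>y. f y \<ge> 0" and
    nu: "\<nu> = density lborel (\<lambda>x. ennreal (f x))"
    using dens by (auto simp: is_continuous_density_def)
  have [measurable]: "f \<in> borel_measurable borel"
    using cont by (rule borel_measurable_continuous_onI)
  have sets_nu: "sets \<nu> = sets borel" by (simp add: nu)
  interpret prob_space \<nu> by fact
  have "(\<integral>\<^sup>+y. ennreal (f y) \<partial>lborel) = 1"
    using emeasure_space_1 by (simp add: nu emeasure_density)
  then have int: "integrable lborel f"
    using nonneg by (intro integrableI_nonneg) auto
  have kernel: "Im (1 / (of_real x + \<i> * of_real e - of_real y)) = - (e / ((y - x)\<^sup>2 + e\<^sup>2))"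
    for e y :: real
    by (simp add: Im_divide power2_commute)
  have "- Im (cauchy_transform \<nu> (of_real x + \<i> * of_real (1 / t)))
      = (\<integral>y. (1 / t) / ((y - x)\<^sup>2 + (1 / t)\<^sup>2) * f y \<partial>lborel)" if t: "t > 0" for t
  proof -
    have "Im (cauchy_transform \<nu> (of_real x + \<i> * of_real (1 / t)))
        = (\<integral>y. Im (1 / (of_real x + \<i> * of_real (1 / t) - of_real y)) \<partial>\<nu>)"
      using t by (intro Im_cauchy_transform prob sets_nu) simp
    also have "\<dots> = (\<integral>y. f y * Im (1 / (of_real x + \<i> * of_real (1 / t) - of_real y)) \<partial>lborel)"
      unfolding nu by (subst integral_density) (auto simp: nonneg)
    also have "\<dots> = (\<integral>y. - ((1 / t) / ((y - x)\<^sup>2 + (1 / t)\<^sup>2) * f y) \<partial>lborel)"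
      unfolding kernel by (simp only: mult_minus_right mult.commute)
    finally show ?thesis by simp
  qed
  then have "\<forall>\<^sub>F t in at_top. (\<integral>y. (1 / t) / ((y - x)\<^sup>2 + (1 / t)\<^sup>2) * f y \<partial>lborel)
       = - Im (cauchy_transform \<nu> (of_real x + \<i> * of_real (1 / t)))"
    by (auto intro: eventually_mono[OF eventually_gt_at_top[of 0]])
  with Poisson_integral_tendsto[OF cont nonneg int, of x]
  have "((\<lambda>t. - Im (cauchy_transform \<nu> (of_real x + \<i> * of_real (1 / t)))) \<longlongrightarrow> pi * f x) at_top"
    by (rule Lim_transform_eventually)
  moreover have "((\<lambda>t. - Im (cauchy_transform \<nu> (of_real x + \<i> * of_real (1 / t)))) \<longlongrightarrow> - Im L) at_top"
    using lim by (intro tendsto_intros)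
  ultimately have "pi * f x = - Im L"
    by (rule tendsto_unique[rotated]) simp
  then show ?thesis by (simp add: field_simps)
qed

section \<open>The two expansions of the Cauchy transform\<close>

text \<open>
  The duality of the two critical values: \<open>t = x powr (- c)\<close> lies in the disc of convergence for the
  parameter \<open>c\<close> exactly when \<open>x\<close> exceeds the radius for \<open>1 / c\<close>.
\<close>

lemma ln_fs_radius_inverse:
  assumes "c > 0"
  shows "ln (fs_radius (1 / c)) = - ln (fs_radius c) / c"
proof -
  have "\<bar>1 - 1 / c\<bar> = \<bar>1 - c\<bar> / c"
    using assms by (simp add: abs_if field_simps)
  then show ?thesis
    using assms by (cases "c = 1") (simp_all add: fs_radius_def ln_div field_simps)
qed

context
  fixes c :: real
  assumes c: "c > 0" "c \<noteq> 1"
begin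

lemma norm_fs_term_le:
  assumes "norm t \<le> fs_radius c"
  shows "norm (fps_nth (fs_fps c) k * t ^ k) \<le> \<bar>fs_coeff c (Suc k)\<bar> * fs_radius c ^ k"
  using assms by (auto simp: fs_fps_def norm_mult norm_power intro!: mult_left_mono power_mono)

lemma fs_fps_sums:
  assumes "norm t \<le> fs_radius c"
  shows "(\<lambda>k. of_real (fs_coeff c (Suc k)) * t ^ k) sums eval_fps (fs_fps c) t"
proof -
  have "summable (\<lambda>k. fps_nth (fs_fps c) k * t ^ k)"
    by (rule summable_comparison_test'[OF summable_fs_coeff[OF c], of 0])
       (use norm_fs_term_le[OF assms] in simp)
  then show ?thesis
    by (simp add: eval_fps_def fs_fps_def summable_sums)
qed

lemma fps_conv_radius_fs: "fps_conv_radius (fs_fps c) \<ge> ereal (fs_radius c)"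
proof -
  have "summable (\<lambda>k. fps_nth (fs_fps c) k * of_real (fs_radius c) ^ k)"
    using fs_fps_sums[of "of_real (fs_radius c)"] fs_radius_pos[of c]
    by (simp add: fs_fps_def sums_iff)
  from conv_radius_geI[OF this] show ?thesis
    using fs_radius_pos[of c] by (simp add: fps_conv_radius_def)
qed

lemma continuous_on_fs: "continuous_on (cball 0 (fs_radius c)) (eval_fps (fs_fps c))"
proof (rule uniform_limit_theorem)
  show "uniform_limit (cball 0 (fs_radius c)) (\<lambda>n t. \<Sum>k<n. fps_nth (fs_fps c) k * t ^ k)
          (eval_fps (fs_fps c)) sequentially"
    unfolding eval_fps_def
    by (rule Weierstrass_m_test[OF norm_fs_term_le summable_fs_coeff[OF c]]) simp
qed (auto intro!: continuous_intros always_eventually)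

text \<open>
  The identity theorem extends the local inversion: along any connected family of solutions that
  comes close to \<open>v = 1\<close> somewhere and keeps \<open>t\<close> inside the disc of convergence, \<open>v powr c\<close> is given by
  the power series.
\<close>

lemma trinomial_solution:
  assumes S: "open S" "connected S"
    and hol: "l holomorphic_on S" "s holomorphic_on S"
    and eq: "\<And>z. z \<in> S \<Longrightarrow> exp (l z) + exp (s z + of_real c * l z) = 1"
    and radius: "\<And>z. z \<in> S \<Longrightarrow> Re (s z) < ln (fs_radius c)"
    and small: "\<And>d. d > 0 \<Longrightarrow> \<exists>z\<in>S. norm (l z) < d"
    and z: "z \<in> S"
  shows "exp (of_real c * l z) = of_real pi * eval_fps (fs_fps c) (exp (s z))"
proof -
  have R: "ereal (fs_radius c) > 0" using fs_radius_pos[of c] by simp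
  have "fps_conv_radius (fs_fps c) > 0"
    using less_le_trans[OF R fps_conv_radius_fs] .
  from trinomial_solution_near_1[OF c(1) this]
  obtain d where d: "d > 0" and near: "\<And>l s. norm l < d \<Longrightarrow> exp l + exp (s + of_real c * l) = 1 \<Longrightarrow>
             exp (of_real c * l) = of_real pi * eval_fps (fs_fps c) (exp s)"
    by (auto simp: eventually_nhds_metric dist_norm)
  define U where "U = {z \<in> S. norm (l z) < d}"
  have "U = S \<inter> l -` ball 0 d" by (auto simp: U_def)
  then have U_open: "open U"
    using hol(1) S(1) by (simp add: continuous_open_preimage holomorphic_on_imp_continuous_on)
  have U: "U \<noteq> {}" "U \<subseteq> S" using small[OF d] by (auto simp: U_def)
  have hol1: "(\<lambda>z. exp (of_real c * l z)) holomorphic_on S"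
    by (intro holomorphic_intros hol)
  have hol2: "(\<lambda>z. of_real pi * (eval_fps (fs_fps c) \<circ> (\<lambda>z. exp (s z))) z) holomorphic_on S"
  proof (intro holomorphic_on_mult holomorphic_on_const holomorphic_on_compose_gen[where t = "ball 0 (fs_radius c)"])
    show "(\<lambda>z. exp (s z)) holomorphic_on S" by (intro holomorphic_intros hol)
    show "eval_fps (fs_fps c) holomorphic_on ball 0 (fs_radius c)"
    proof (intro holomorphic_on_eval_fps subsetI)
      fix x :: complex assume "x \<in> ball 0 (fs_radius c)"
      then have "ereal (norm x) < ereal (fs_radius c)" by simp
      then have "ereal (norm x) < fps_conv_radius (fs_fps c)"
        using fps_conv_radius_fs by (rule less_le_trans)
      then show "x \<in> eball 0 (fps_conv_radius (fs_fps c))"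
        by (simp add: in_eball_iff)
    qed
    have "norm (exp (s z)) < fs_radius c" if "z \<in> S" for z
      using radius[OF that] fs_radius_pos[of c] by (metis exp_ln exp_less_mono norm_exp_eq_Re)
    then show "(\<lambda>z. exp (s z)) ` S \<subseteq> ball 0 (fs_radius c)" by auto
  qed
  have agree: "exp (of_real c * l z) = of_real pi * (eval_fps (fs_fps c) \<circ> (\<lambda>z. exp (s z))) z"
    if "z \<in> U" for z
    using that near eq by (auto simp: U_def)
  have "exp (of_real c * l z) = of_real pi * (eval_fps (fs_fps c) \<circ> (\<lambda>z. exp (s z))) z"
    by (rule analytic_continuation_open[OF U_open S(1) U(1) S(2) U(2) hol1 hol2 agree z])
  then show ?thesis by simp
qed

end

text \<open>
  The two inequalities on \<open>\<alpha> * \<rho>\<close> and \<open>\<alpha> * (1 - \<rho>)\<close> are the form in which admissibility enters: they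
  confine the imaginary part of the logarithm in \<open>transform_inside\<close> to \<open>(- \<pi>, \<pi>)\<close>.
\<close>

lemma admissible_bounds:
  assumes "(\<alpha>, \<rho>) \<in> admissible_params"
  shows "\<alpha> > 0" "\<alpha> \<noteq> 1" "0 \<le> \<rho>" "\<rho> \<le> 1" "\<alpha> * \<rho> \<le> 1" "\<alpha> * (1 - \<rho>) \<le> 1"
proof -
  consider "0 < \<alpha>" "\<alpha> < 1" "0 \<le> \<rho>" "\<rho> \<le> 1"
    | "1 < \<alpha>" "\<alpha> \<le> 2" "1 - 1 / \<alpha> \<le> \<rho>" "\<rho> \<le> 1 / \<alpha>"
    using assms by (auto simp: admissible_params_def)
  then have "0 < \<alpha> \<and> \<alpha> \<noteq> 1 \<and> 0 \<le> \<rho> \<and> \<rho> \<le> 1 \<and> \<alpha> * \<rho> \<le> 1 \<and> \<alpha> * (1 - \<rho>) \<le> 1"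
  proof cases
    case 1
    then show "0 < \<alpha> \<and> \<alpha> \<noteq> 1 \<and> 0 \<le> \<rho> \<and> \<rho> \<le> 1 \<and> \<alpha> * \<rho> \<le> 1 \<and> \<alpha> * (1 - \<rho>) \<le> 1"
      using mult_le_one[of \<alpha> \<rho>] mult_le_one[of \<alpha> "1 - \<rho>"] by auto
  next
    case 2
    then have "1 / \<alpha> < 1" "\<alpha> * (1 / \<alpha>) = 1" by auto
    moreover have "\<alpha> * \<rho> \<le> \<alpha> * (1 / \<alpha>)" "\<alpha> * (1 - \<rho>) \<le> \<alpha> * (1 / \<alpha>)"
      using 2 by (auto intro!: mult_left_mono simp del: times_divide_eq_right)
    ultimately show "0 < \<alpha> \<and> \<alpha> \<noteq> 1 \<and> 0 \<le> \<rho> \<and> \<rho> \<le> 1 \<and> \<alpha> * \<rho> \<le> 1 \<and> \<alpha> * (1 - \<rho>) \<le> 1"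
      using 2 by linarith
  qed
  then show "\<alpha> > 0" "\<alpha> \<noteq> 1" "0 \<le> \<rho>" "\<rho> \<le> 1" "\<alpha> * \<rho> \<le> 1" "\<alpha> * (1 - \<rho>) \<le> 1"
    by auto
qed

lemma exp_vertical: "exp (of_real t + \<i> * of_real (pi / 2)) = \<i> * of_real (exp t)"
proof -
  have "exp (\<i> * of_real (pi / 2)) = \<i>"
    by (metis cis_conv_exp cis_pi_half)
  then show ?thesis by (simp only: exp_add exp_of_real mult.commute)
qed

context
  fixes \<nu> :: "real measure" and \<alpha> \<rho> :: real
  assumes adm: "(\<alpha>, \<rho>) \<in> admissible_params" and stable: "is_free_stable \<alpha> \<rho> \<nu>"
begin

text \<open>
  With \<open>z = exp \<zeta>\<close> the upper half-plane becomes the strip \<open>0 < Im \<zeta> < \<pi>\<close>, and the reciprocal of the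
  Cauchy transform, which again has positive imaginary part, has a logarithm in the same strip. All
  powers in the functional equation are then exponentials of linear expressions.
\<close>

definition log_recip :: "complex \<Rightarrow> complex" where
  "log_recip \<zeta> = Ln (1 / cauchy_transform \<nu> (exp \<zeta>))"

lemma free_stable_prob_space: "prob_space \<nu>" and free_stable_sets: "sets \<nu> = sets borel"
  using stable by (auto simp: is_free_stable_def)

lemmas params = admissible_bounds[OF adm]

lemma Im_exp_strip:
  assumes "0 < Im \<zeta>" "Im \<zeta> < pi"
  shows "Im (exp \<zeta>) > 0"
  using assms by (simp add: Im_exp sin_gt_zero)

lemma Im_inverse_transform_pos:
  assumes "0 < Im \<zeta>" "Im \<zeta> < pi"
  shows "Im (1 / cauchy_transform \<nu> (exp \<zeta>)) > 0"
proof -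
  have "Im (cauchy_transform \<nu> (exp \<zeta>)) < 0"
    using Im_exp_strip[OF assms] by (rule Im_cauchy_transform_neg[OF free_stable_prob_space free_stable_sets])
  then show ?thesis
    by (simp add: Im_divide divide_neg_pos add_nonneg_pos)
qed

lemma exp_log_recip:
  assumes "0 < Im \<zeta>" "Im \<zeta> < pi"
  shows "exp (log_recip \<zeta>) = 1 / cauchy_transform \<nu> (exp \<zeta>)"
    and "cauchy_transform \<nu> (exp \<zeta>) = exp (- log_recip \<zeta>)"
    and "0 < Im (log_recip \<zeta>)" "Im (log_recip \<zeta>) < pi"
proof -
  have pos: "Im (1 / cauchy_transform \<nu> (exp \<zeta>)) > 0"
    using assms by (rule Im_inverse_transform_pos)
  then have "cauchy_transform \<nu> (exp \<zeta>) \<noteq> 0" by auto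
  then show "exp (log_recip \<zeta>) = 1 / cauchy_transform \<nu> (exp \<zeta>)"
    by (simp add: log_recip_def)
  then show "cauchy_transform \<nu> (exp \<zeta>) = exp (- log_recip \<zeta>)"
    by (simp add: exp_minus)
  show "0 < Im (log_recip \<zeta>)" "Im (log_recip \<zeta>) < pi"
    using Im_Ln_pos_lt_imp[OF pos] by (simp_all add: log_recip_def)
qed

text \<open>
  The equation of the Voiculescu transform divided by the reciprocal Cauchy transform. The two
  summands have equal standing: solving for the first gives the expansion at infinity, solving for
  the second the one at zero.
\<close>

lemma trinomial_equation:
  assumes "0 < Im \<zeta>" "Im \<zeta> < pi"
  shows "exp (\<zeta> - log_recip \<zeta>) + exp (\<i> * of_real (pi * \<alpha> * \<rho>) - of_real \<alpha> * log_recip \<zeta>) = 1"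
proof -
  define u where "u = 1 / cauchy_transform \<nu> (exp \<zeta>)"
  have u: "u = exp (log_recip \<zeta>)" "Ln u = log_recip \<zeta>"
    using exp_log_recip(1)[OF assms] by (simp_all add: u_def log_recip_def)
  have "exp \<zeta> = u + free_stable_phi \<alpha> \<rho> u"
    using stable Im_exp_strip[OF assms]
    by (simp add: is_free_stable_def has_voiculescu_transform_def u_def)
  also have "free_stable_phi \<alpha> \<rho> u = - exp (\<i> * of_real (pi * \<alpha> * \<rho>) + of_real (1 - \<alpha>) * log_recip \<zeta>)"
  proof -
    have "u \<noteq> 0" by (simp add: u)
    then have "free_stable_phi \<alpha> \<rho> u
        = - (exp (of_real pi * \<i> * of_real \<alpha> * of_real \<rho>) * exp (of_real (- \<alpha> + 1) * log_recip \<zeta>))"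
      unfolding free_stable_phi_def powr_def u(2) by simp
    also have "\<dots> = - exp (\<i> * of_real (pi * \<alpha> * \<rho>) + of_real (1 - \<alpha>) * log_recip \<zeta>)"
      unfolding exp_add[symmetric] by (simp add: algebra_simps)
    finally show ?thesis .
  qed
  finally have "exp (\<zeta> - log_recip \<zeta>) =
      (exp (log_recip \<zeta>) - exp (\<i> * of_real (pi * \<alpha> * \<rho>) + of_real (1 - \<alpha>) * log_recip \<zeta>)) * exp (- log_recip \<zeta>)"
    by (simp add: u(1) exp_diff exp_minus divide_inverse)
  also have "\<dots> = 1 - exp (\<i> * of_real (pi * \<alpha> * \<rho>) - of_real \<alpha> * log_recip \<zeta>)"
    unfolding left_diff_distrib exp_add[symmetric] by (simp add: algebra_simps)
  finally show ?thesis by simp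
qed

lemma holomorphic_log_recip: "log_recip holomorphic_on {\<zeta>. 0 < Im \<zeta> \<and> Im \<zeta> < pi}"
proof -
  let ?S = "{\<zeta>. 0 < Im \<zeta> \<and> Im \<zeta> < pi}"
  have "(cauchy_transform \<nu> \<circ> exp) holomorphic_on ?S"
    by (rule holomorphic_on_compose_gen[OF _ holomorphic_cauchy_transform[OF free_stable_prob_space free_stable_sets]])
       (auto intro: holomorphic_intros Im_exp_strip)
  then have "(\<lambda>\<zeta>. cauchy_transform \<nu> (exp \<zeta>)) holomorphic_on ?S"
    by (simp only: o_def)
  moreover have "cauchy_transform \<nu> (exp \<zeta>) \<noteq> 0" if "\<zeta> \<in> ?S" for \<zeta>
    using Im_inverse_transform_pos[of \<zeta>] that by auto
  ultimately have "(\<lambda>\<zeta>. 1 / cauchy_transform \<nu> (exp \<zeta>)) holomorphic_on ?S"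
    by (intro holomorphic_on_divide holomorphic_on_const) auto
  moreover have "1 / cauchy_transform \<nu> (exp \<zeta>) \<notin> \<real>\<^sub>\<le>\<^sub>0" if "\<zeta> \<in> ?S" for \<zeta>
    using Im_inverse_transform_pos[of \<zeta>] that by (auto simp: complex_nonpos_Reals_iff)
  ultimately show ?thesis
    unfolding log_recip_def by (intro holomorphic_on_Ln') auto
qed

text \<open>
  Here the unknown is \<open>v = exp l = z * G(z)\<close> with parameter \<open>c = \<alpha>\<close> and
  \<open>t = exp (\<i> * \<pi> * \<alpha> * \<rho>) * z powr (- \<alpha>)\<close>. Since \<open>z * G(z)\<close> tends to \<open>1\<close> along the imaginary axis, the
  solution belongs to the branch near \<open>1\<close>.
\<close>

lemma transform_outside:
  assumes \<zeta>: "0 < Im \<zeta>" "Im \<zeta> < pi" and large: "Re \<zeta> > ln (fs_radius (1 / \<alpha>))"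
  defines "\<tau> \<equiv> exp (\<i> * of_real (pi * \<alpha> * \<rho>) - of_real \<alpha> * \<zeta>)"
  shows "cauchy_transform \<nu> (exp \<zeta>) = exp (- \<zeta>) * (1 - of_real pi * \<tau> * eval_fps (fs_fps \<alpha>) \<tau>)"
proof -
  define T where "T = {\<zeta>. (0 < Im \<zeta> \<and> Im \<zeta> < pi) \<and> Re \<zeta> > ln (fs_radius (1 / \<alpha>))}"
  define l where "l = (\<lambda>\<zeta>. \<zeta> - log_recip \<zeta>)"
  define s where "s = (\<lambda>\<zeta>. \<i> * of_real (pi * \<alpha> * \<rho>) - of_real \<alpha> * \<zeta>)"
  have arg: "s \<zeta> + of_real \<alpha> * l \<zeta> = \<i> * of_real (pi * \<alpha> * \<rho>) - of_real \<alpha> * log_recip \<zeta>" for \<zeta>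
    by (simp add: s_def l_def algebra_simps)
  have small: "\<exists>\<zeta>\<in>T. norm (l \<zeta>) < d" if d: "d > 0" for d
  proof -
    define p where "p = (\<lambda>t::real. of_real t + \<i> * of_real (pi / 2))"
    have p: "exp (p t) = \<i> * of_real (exp t)" for t
      unfolding p_def by (rule exp_vertical)
    have strip: "0 < Im (p t)" "Im (p t) < pi" for t
      using pi_gt_zero by (auto simp: p_def)
    have el: "exp (l (p t)) = \<i> * of_real (exp t) * cauchy_transform \<nu> (\<i> * of_real (exp t))" for t
      using exp_log_recip(2)[OF strip] p by (simp add: l_def exp_diff exp_minus divide_inverse)
    have "((\<lambda>t. exp (l (p t))) \<longlongrightarrow> 1) at_top"
      unfolding el by (rule z_cauchy_transform_at_i_infinity[OF free_stable_prob_space free_stable_sets])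
    then have "((\<lambda>t. Ln (exp (l (p t)))) \<longlongrightarrow> Ln 1) at_top"
      by (intro tendsto_Ln) auto
    \<comment> \<open>On the line \<open>Im \<zeta> = \<pi> / 2\<close> the imaginary part of \<open>l\<close> lies in \<open>(- \<pi> / 2, \<pi> / 2)\<close>, so \<open>l\<close> is the
      principal logarithm and not merely some logarithm.\<close>
    moreover have "Ln (exp (l (p t))) = l (p t)" for t
      using exp_log_recip(3,4)[OF strip[of t]] by (intro Ln_exp) (auto simp: l_def p_def)
    ultimately have "((\<lambda>t. l (p t)) \<longlongrightarrow> 0) at_top" by simp
    then have "\<forall>\<^sub>F t in at_top. norm (l (p t)) < d"
      using d by (auto simp: tendsto_iff)
    then have "\<forall>\<^sub>F t in at_top. norm (l (p t)) < d \<and> p t \<in> T"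
      using eventually_gt_at_top[of "ln (fs_radius (1 / \<alpha>))"]
      by eventually_elim (use strip in \<open>auto simp: T_def p_def\<close>)
    then show ?thesis
      using eventually_happens[of _ "at_top :: real filter"] by fastforce
  qed
  have *: "exp (of_real \<alpha> * l \<zeta>) = of_real pi * eval_fps (fs_fps \<alpha>) (exp (s \<zeta>))"
  proof (rule trinomial_solution[where S = T and l = l and s = s and z = \<zeta>])
    show "open T" unfolding T_def
      by (intro open_Collect_conj open_Collect_less continuous_intros)
    have "T = {\<zeta>. Im \<zeta> > 0} \<inter> {\<zeta>. Im \<zeta> < pi} \<inter> {\<zeta>. Re \<zeta> > ln (fs_radius (1 / \<alpha>))}"
      by (auto simp: T_def)
    then show "connected T"
      by (auto intro!: convex_connected convex_Int convex_halfspace_Im_gt convex_halfspace_Im_lt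
            convex_halfspace_Re_gt)
    show "l holomorphic_on T" unfolding l_def
      by (intro holomorphic_intros holomorphic_on_subset[OF holomorphic_log_recip]) (auto simp: T_def)
    show "s holomorphic_on T" unfolding s_def by (intro holomorphic_intros)
    show "Re (s \<zeta>) < ln (fs_radius \<alpha>)" if "\<zeta> \<in> T" for \<zeta>
      using that params(1) by (simp add: T_def s_def ln_fs_radius_inverse field_simps)
    show "exp (l \<zeta>) + exp (s \<zeta> + of_real \<alpha> * l \<zeta>) = 1" if "\<zeta> \<in> T" for \<zeta>
      unfolding arg using that trinomial_equation[of \<zeta>] by (simp add: T_def l_def)
    show "\<zeta> \<in> T" using \<zeta> large by (simp add: T_def)
  qed (use params small in auto)
  have "exp (l \<zeta>) = 1 - of_real pi * \<tau> * eval_fps (fs_fps \<alpha>) \<tau>"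
  proof -
    have "exp (l \<zeta>) = 1 - exp (s \<zeta> + of_real \<alpha> * l \<zeta>)"
      unfolding arg using trinomial_equation[OF \<zeta>] by (simp add: l_def eq_diff_eq)
    also have "exp (s \<zeta> + of_real \<alpha> * l \<zeta>) = \<tau> * exp (of_real \<alpha> * l \<zeta>)"
      by (simp only: exp_add \<tau>_def s_def)
    also note *
    finally show ?thesis by (simp only: \<tau>_def s_def mult_ac)
  qed
  moreover have "cauchy_transform \<nu> (exp \<zeta>) = exp (- \<zeta>) * exp (l \<zeta>)"
    using exp_log_recip(2)[OF \<zeta>] by (simp add: l_def flip: exp_add)
  ultimately show ?thesis by simp
qed

text \<open>
  Here the unknown is \<open>v = exp l = 1 - z * G(z)\<close> with parameter \<open>c = 1 / \<alpha>\<close> and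
  \<open>t = exp (- \<i> * \<pi> * \<rho>) * z\<close>. It tends to \<open>1\<close> at the origin because the measure has no atom there, and
  admissibility of the parameters ensures that the logarithm \<open>l\<close> tends to \<open>0\<close> rather than to another
  multiple of \<open>2 * \<pi> * \<i>\<close>.
\<close>

lemma transform_inside:
  assumes \<zeta>: "0 < Im \<zeta>" "Im \<zeta> < pi" and less: "Re \<zeta> < ln (fs_radius (1 / \<alpha>))"
    and no_atom: "AE x in \<nu>. x \<noteq> 0"
  defines "\<tau> \<equiv> exp (\<zeta> - \<i> * of_real (pi * \<rho>))"
  shows "cauchy_transform \<nu> (exp \<zeta>) = exp (- \<i> * of_real (pi * \<rho>)) * of_real pi * eval_fps (fs_fps (1 / \<alpha>)) \<tau>"
proof -
  define T where "T = {\<zeta>. (0 < Im \<zeta> \<and> Im \<zeta> < pi) \<and> Re \<zeta> < ln (fs_radius (1 / \<alpha>))}"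
  define l where "l = (\<lambda>\<zeta>. \<i> * of_real (pi * \<alpha> * \<rho>) - of_real \<alpha> * log_recip \<zeta>)"
  define s where "s = (\<lambda>\<zeta>. \<zeta> - \<i> * of_real (pi * \<rho>))"
  have l_div: "of_real (1 / \<alpha>) * l \<zeta> = \<i> * of_real (pi * \<rho>) - log_recip \<zeta>" for \<zeta>
    using params(1) by (simp add: l_def field_simps)
  have arg: "s \<zeta> + of_real (1 / \<alpha>) * l \<zeta> = \<zeta> - log_recip \<zeta>" for \<zeta>
    unfolding l_div by (simp add: s_def)
  have small: "\<exists>\<zeta>\<in>T. norm (l \<zeta>) < d" if d: "d > 0" for d
  proof -
    define p where "p = (\<lambda>t::real. of_real (- t) + \<i> * of_real (pi / 2))"
    have p: "exp (p t) = \<i> * of_real (exp (- t))" for t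
      unfolding p_def by (rule exp_vertical)
    have strip: "0 < Im (p t)" "Im (p t) < pi" for t
      using pi_gt_zero by (auto simp: p_def)
    have el: "exp (l (p t)) = 1 - \<i> * of_real (exp (- t)) * cauchy_transform \<nu> (\<i> * of_real (exp (- t)))" for t
    proof -
      have "exp (p t - log_recip (p t)) = \<i> * of_real (exp (- t)) * cauchy_transform \<nu> (\<i> * of_real (exp (- t)))"
        using exp_log_recip(2)[OF strip, of t] p[of t] by (simp add: exp_diff exp_minus divide_inverse)
      then show ?thesis
        using trinomial_equation[OF strip, of t] by (simp add: l_def algebra_simps)
    qed
    have "((\<lambda>t. exp (l (p t))) \<longlongrightarrow> 1 - 0) at_top"
      unfolding el by (intro tendsto_intros z_cauchy_transform_at_0[OF free_stable_prob_space free_stable_sets no_atom])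
    then have "((\<lambda>t. Ln (exp (l (p t)))) \<longlongrightarrow> Ln 1) at_top"
      by (intro tendsto_Ln) auto
    moreover have "Ln (exp (l (p t))) = l (p t)" for t
    proof (rule Ln_exp)
      define h where "h = Im (log_recip (p t))"
      have h: "0 < h" "h < pi" using exp_log_recip(3,4)[OF strip[of t]] by (auto simp: h_def)
      have Im_l: "Im (l (p t)) = pi * (\<alpha> * \<rho>) - \<alpha> * h" by (simp add: l_def h_def mult_ac)
      have "\<alpha> * h > 0" "\<alpha> * h < \<alpha> * pi" using h params(1) by auto
      moreover have "pi * (\<alpha> * \<rho>) \<le> pi" "pi * (\<alpha> * (1 - \<rho>)) \<le> pi"
        using params mult_left_mono[of _ 1 pi] by auto
      moreover have "pi * (\<alpha> * (1 - \<rho>)) = \<alpha> * pi - pi * (\<alpha> * \<rho>)"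
        by (simp add: algebra_simps)
      ultimately show "- pi < Im (l (p t))" "Im (l (p t)) \<le> pi"
        unfolding Im_l by linarith+
    qed
    ultimately have "((\<lambda>t. l (p t)) \<longlongrightarrow> 0) at_top" by simp
    then have "\<forall>\<^sub>F t in at_top. norm (l (p t)) < d"
      using d by (auto simp: tendsto_iff)
    then have "\<forall>\<^sub>F t in at_top. norm (l (p t)) < d \<and> p t \<in> T"
      using eventually_gt_at_top[of "- ln (fs_radius (1 / \<alpha>))"]
      by eventually_elim (use strip in \<open>auto simp: T_def p_def\<close>)
    then show ?thesis
      using eventually_happens[of _ "at_top :: real filter"] by fastforce
  qed
  have "exp (of_real (1 / \<alpha>) * l \<zeta>) = of_real pi * eval_fps (fs_fps (1 / \<alpha>)) (exp (s \<zeta>))"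
  proof (rule trinomial_solution[where S = T and l = l and s = s and z = \<zeta>])
    show "open T" unfolding T_def
      by (intro open_Collect_conj open_Collect_less continuous_intros)
    have "T = {\<zeta>. Im \<zeta> > 0} \<inter> {\<zeta>. Im \<zeta> < pi} \<inter> {\<zeta>. Re \<zeta> < ln (fs_radius (1 / \<alpha>))}"
      by (auto simp: T_def)
    then show "connected T"
      by (auto intro!: convex_connected convex_Int convex_halfspace_Im_gt convex_halfspace_Im_lt
            convex_halfspace_Re_lt)
    show "l holomorphic_on T" unfolding l_def
      by (intro holomorphic_intros holomorphic_on_subset[OF holomorphic_log_recip]) (auto simp: T_def)
    show "s holomorphic_on T" unfolding s_def by (intro holomorphic_intros)
    show "Re (s \<zeta>) < ln (fs_radius (1 / \<alpha>))" if "\<zeta> \<in> T" for \<zeta>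
      using that by (simp add: T_def s_def)
    show "exp (l \<zeta>) + exp (s \<zeta> + of_real (1 / \<alpha>) * l \<zeta>) = 1" if "\<zeta> \<in> T" for \<zeta>
      unfolding arg using that trinomial_equation[of \<zeta>] by (simp add: T_def l_def add.commute)
    show "\<zeta> \<in> T" using \<zeta> less by (simp add: T_def)
  qed (use params small in auto)
  then have "exp (\<i> * of_real (pi * \<rho>) - log_recip \<zeta>) = of_real pi * eval_fps (fs_fps (1 / \<alpha>)) \<tau>"
    unfolding l_div by (simp add: \<tau>_def s_def)
  moreover have "exp (- log_recip \<zeta>) = exp (- \<i> * of_real (pi * \<rho>)) * exp (\<i> * of_real (pi * \<rho>) - log_recip \<zeta>)"
    by (simp flip: exp_add)
  ultimately show ?thesis
    using exp_log_recip(2)[OF \<zeta>] by (simp add: mult.assoc)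
qed

end

section \<open>Series, duality and reflection of the densities\<close>

lemma Im_of_real_mult: "Im (of_real a * z) = a * Im z"
  by simp

lemma tendsto_Ln_boundary:
  assumes "x > 0"
  shows "((\<lambda>t. Ln (of_real x + \<i> * of_real (1 / t))) \<longlongrightarrow> of_real (ln x)) at_top"
proof -
  have "((\<lambda>t::real. 1 / t) \<longlongrightarrow> 0) at_top" by real_asymp
  then have "((\<lambda>t. of_real x + \<i> * of_real (1 / t)) \<longlongrightarrow> of_real x + \<i> * of_real 0) at_top"
    by (intro tendsto_intros)
  then have "((\<lambda>t. Ln (of_real x + \<i> * of_real (1 / t))) \<longlongrightarrow> Ln (of_real x)) at_top"
    using assms by (intro tendsto_Ln) (auto simp: complex_nonpos_Reals_iff)
  then show ?thesis using assms by (simp add: Ln_of_real)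
qed

lemma tendsto_eval_fs:
  assumes c: "c > 0" "c \<noteq> 1" and f: "(f \<longlongrightarrow> \<tau>) F" and \<tau>: "norm \<tau> < fs_radius c"
  shows "((\<lambda>t. eval_fps (fs_fps c) (f t)) \<longlongrightarrow> eval_fps (fs_fps c) \<tau>) F"
proof -
  have "continuous_on (ball 0 (fs_radius c)) (eval_fps (fs_fps c))"
    by (rule continuous_on_subset[OF continuous_on_fs[OF c]]) auto
  then have "isCont (eval_fps (fs_fps c)) \<tau>"
    using \<tau> by (simp add: continuous_on_eq_continuous_at)
  then show ?thesis using f by (rule isCont_tendsto_compose)
qed

lemma x_star_eq: "0 < \<alpha> \<Longrightarrow> \<alpha> < 1 \<Longrightarrow> x_star \<alpha> = fs_radius (1 / \<alpha>)"
proof -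
  assume \<alpha>: "0 < \<alpha>" "\<alpha> < 1"
  have "\<bar>1 - 1 / \<alpha>\<bar> = (1 - \<alpha>) / \<alpha>" using \<alpha> by (simp add: abs_if field_simps)
  then have "fs_radius (1 / \<alpha>) = exp (ln \<alpha> + (1 / \<alpha> - 1) * ln (1 - \<alpha>))"
    using \<alpha> by (simp add: fs_radius_def ln_div field_simps)
  then show ?thesis using \<alpha> by (simp add: x_star_def exp_add powr_def)
qed

lemma y_star_eq: "1 < \<alpha> \<Longrightarrow> y_star \<alpha> = fs_radius \<alpha>"
  using x_star_eq[of "1 / \<alpha>"] by (simp add: x_star_def y_star_def)

context
  fixes \<nu> :: "real measure" and \<psi> :: "real \<Rightarrow> real" and \<alpha> \<rho> :: real
  assumes adm: "(\<alpha>, \<rho>) \<in> admissible_params" and stable: "is_free_stable \<alpha> \<rho> \<nu>"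
    and dens: "is_continuous_density \<nu> \<psi>"
begin

lemmas bounds = admissible_bounds[OF adm]

lemma density_continuous: "continuous_on UNIV \<psi>"
  using dens by (simp add: is_continuous_density_def)

text \<open>
  Absolute continuity excludes an atom at \<open>0\<close>, which is what fixes the branch of the expansion at zero.
\<close>

lemma AE_nonzero: "AE x in \<nu>. x \<noteq> 0"
proof -
  have [measurable]: "\<psi> \<in> borel_measurable borel"
    using density_continuous by (rule borel_measurable_continuous_onI)
  have \<nu>_eq: "\<nu> = density lborel (\<lambda>x. ennreal (\<psi> x))"
    using dens by (simp add: is_continuous_density_def)
  have "AE x in lborel. x \<noteq> (0::real)" by (rule AE_lborel_singleton)
  then show ?thesis
    unfolding \<nu>_eq by (subst AE_density) (auto elim: eventually_mono)
qed

text \<open>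
  Strictly outside the critical point the boundary value lies in the open disc of convergence, so the
  Cauchy transform extends continuously to the real axis and Stieltjes inversion applies.
\<close>

lemma density_outside_open:
  assumes x: "x > fs_radius (1 / \<alpha>)"
  defines "\<tau> \<equiv> exp (\<i> * of_real (pi * \<alpha> * \<rho>) - of_real \<alpha> * of_real (ln x))"
  shows "\<psi> x = Im (\<tau> * eval_fps (fs_fps \<alpha>) \<tau>) / x"
proof -
  have x0: "x > 0" using x fs_radius_pos[of "1 / \<alpha>"] by linarith
  have lnx: "ln x > ln (fs_radius (1 / \<alpha>))" using x x0 fs_radius_pos by simp
  define \<zeta> where "\<zeta> = (\<lambda>t::real. Ln (of_real x + \<i> * of_real (1 / t)))"
  define h where "h = (\<lambda>\<zeta>. exp (\<i> * of_real (pi * \<alpha> * \<rho>) - of_real \<alpha> * \<zeta>))"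
  have lim: "(\<zeta> \<longlongrightarrow> of_real (ln x)) at_top"
    unfolding \<zeta>_def using x0 by (rule tendsto_Ln_boundary)
  have "- (\<alpha> * ln x) < ln (fs_radius \<alpha>)"
    using lnx bounds(1) by (simp add: ln_fs_radius_inverse field_simps)
  then have "exp (- (\<alpha> * ln x)) < fs_radius \<alpha>"
    using fs_radius_pos[of \<alpha>] by (metis exp_less_mono exp_ln)
  then have \<tau>: "norm \<tau> < fs_radius \<alpha>"
    by (simp add: \<tau>_def)
  have h: "((\<lambda>t. h (\<zeta> t)) \<longlongrightarrow> \<tau>) at_top"
    unfolding h_def \<tau>_def by (intro tendsto_intros lim)
  have "((\<lambda>t. exp (- \<zeta> t) * (1 - of_real pi * h (\<zeta> t) * eval_fps (fs_fps \<alpha>) (h (\<zeta> t))))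
          \<longlongrightarrow> exp (- of_real (ln x)) * (1 - of_real pi * \<tau> * eval_fps (fs_fps \<alpha>) \<tau>)) at_top"
    by (intro tendsto_intros lim h tendsto_eval_fs bounds \<tau>)
  moreover have "\<forall>\<^sub>F t in at_top. Re (\<zeta> t) > ln (fs_radius (1 / \<alpha>))"
    using tendsto_Re[OF lim] lnx by (intro order_tendstoD) auto
  then have "\<forall>\<^sub>F t in at_top. exp (- \<zeta> t) * (1 - of_real pi * h (\<zeta> t) * eval_fps (fs_fps \<alpha>) (h (\<zeta> t)))
      = cauchy_transform \<nu> (of_real x + \<i> * of_real (1 / t))"
    using eventually_gt_at_top[of 0]
  proof eventually_elim
    case (elim t)
    have Im_pos: "Im (of_real x + \<i> * of_real (1 / t)) > 0" using elim(2) by simp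
    then have "of_real x + \<i> * of_real (1 / t) \<noteq> 0" by (metis less_irrefl zero_complex.sel(2))
    then have "exp (\<zeta> t) = of_real x + \<i> * of_real (1 / t)"
      unfolding \<zeta>_def by (rule exp_Ln)
    moreover have "0 < Im (\<zeta> t)" "Im (\<zeta> t) < pi"
      using Im_Ln_pos_lt_imp[OF Im_pos] unfolding \<zeta>_def by auto
    ultimately show ?case
      using transform_outside[OF adm stable, of "\<zeta> t"] elim(1) unfolding h_def by simp
  qed
  ultimately have "((\<lambda>t. cauchy_transform \<nu> (of_real x + \<i> * of_real (1 / t)))
      \<longlongrightarrow> exp (- of_real (ln x)) * (1 - of_real pi * \<tau> * eval_fps (fs_fps \<alpha>) \<tau>)) at_top"
    by (rule Lim_transform_eventually)
  also have "exp (- of_real (ln x)) = (of_real (1 / x) :: complex)"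
    using x0 by (simp add: exp_minus exp_of_real divide_inverse flip: of_real_inverse)
  finally have "\<psi> x = - Im (of_real (1 / x) * (1 - of_real pi * \<tau> * eval_fps (fs_fps \<alpha>) \<tau>)) / pi"
    using Stieltjes_inversion[OF free_stable_prob_space[OF adm stable] dens] by blast
  also have "of_real (1 / x) * (1 - of_real pi * \<tau> * eval_fps (fs_fps \<alpha>) \<tau>)
      = of_real (1 / x) - of_real (pi / x) * (\<tau> * eval_fps (fs_fps \<alpha>) \<tau>)"
    by (simp add: algebra_simps)
  finally show ?thesis
    unfolding minus_complex.sel Im_of_real_mult by (simp only: Im_complex_of_real) simp
qed

lemma density_inside_open:
  assumes x: "0 < x" "x < fs_radius (1 / \<alpha>)"
  defines "\<tau> \<equiv> exp (of_real (ln x) - \<i> * of_real (pi * \<rho>))"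
  shows "\<psi> x = - Im (exp (- \<i> * of_real (pi * \<rho>)) * eval_fps (fs_fps (1 / \<alpha>)) \<tau>)"
proof -
  have lnx: "ln x < ln (fs_radius (1 / \<alpha>))" using x fs_radius_pos by simp
  define \<zeta> where "\<zeta> = (\<lambda>t::real. Ln (of_real x + \<i> * of_real (1 / t)))"
  define h where "h = (\<lambda>\<zeta>. exp (\<zeta> - \<i> * of_real (pi * \<rho>)))"
  have lim: "(\<zeta> \<longlongrightarrow> of_real (ln x)) at_top"
    unfolding \<zeta>_def using x(1) by (rule tendsto_Ln_boundary)
  have \<tau>: "norm \<tau> < fs_radius (1 / \<alpha>)"
    using x by (simp add: \<tau>_def)
  have h: "((\<lambda>t. h (\<zeta> t)) \<longlongrightarrow> \<tau>) at_top"
    unfolding h_def \<tau>_def by (intro tendsto_intros lim)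
  have "((\<lambda>t. exp (- \<i> * of_real (pi * \<rho>)) * of_real pi * eval_fps (fs_fps (1 / \<alpha>)) (h (\<zeta> t)))
          \<longlongrightarrow> exp (- \<i> * of_real (pi * \<rho>)) * of_real pi * eval_fps (fs_fps (1 / \<alpha>)) \<tau>) at_top"
    using bounds by (intro tendsto_intros h tendsto_eval_fs \<tau>) auto
  moreover have "\<forall>\<^sub>F t in at_top. Re (\<zeta> t) < ln (fs_radius (1 / \<alpha>))"
    using tendsto_Re[OF lim] lnx by (intro order_tendstoD) auto
  then have "\<forall>\<^sub>F t in at_top. exp (- \<i> * of_real (pi * \<rho>)) * of_real pi * eval_fps (fs_fps (1 / \<alpha>)) (h (\<zeta> t))
      = cauchy_transform \<nu> (of_real x + \<i> * of_real (1 / t))"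
    using eventually_gt_at_top[of 0]
  proof eventually_elim
    case (elim t)
    have Im_pos: "Im (of_real x + \<i> * of_real (1 / t)) > 0" using elim(2) by simp
    then have "of_real x + \<i> * of_real (1 / t) \<noteq> 0" by (metis less_irrefl zero_complex.sel(2))
    then have "exp (\<zeta> t) = of_real x + \<i> * of_real (1 / t)"
      unfolding \<zeta>_def by (rule exp_Ln)
    moreover have "0 < Im (\<zeta> t)" "Im (\<zeta> t) < pi"
      using Im_Ln_pos_lt_imp[OF Im_pos] unfolding \<zeta>_def by auto
    ultimately show ?case
      using transform_inside[OF adm stable, of "\<zeta> t"] elim(1) AE_nonzero unfolding h_def by simp
  qed
  ultimately have "((\<lambda>t. cauchy_transform \<nu> (of_real x + \<i> * of_real (1 / t)))
      \<longlongrightarrow> exp (- \<i> * of_real (pi * \<rho>)) * of_real pi * eval_fps (fs_fps (1 / \<alpha>)) \<tau>) at_top"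
    by (rule Lim_transform_eventually)
  then have "\<psi> x = - Im (exp (- \<i> * of_real (pi * \<rho>)) * of_real pi * eval_fps (fs_fps (1 / \<alpha>)) \<tau>) / pi"
    using Stieltjes_inversion[OF free_stable_prob_space[OF adm stable] dens] by blast
  also have "exp (- \<i> * of_real (pi * \<rho>)) * of_real pi * eval_fps (fs_fps (1 / \<alpha>)) \<tau>
      = of_real pi * (exp (- \<i> * of_real (pi * \<rho>)) * eval_fps (fs_fps (1 / \<alpha>)) \<tau>)"
    by (simp only: mult_ac)
  finally show ?thesis
    by (simp only: Im_of_real_mult) simp
qed

text \<open>
  The critical point itself is reached by continuity, as the power series is continuous on the closed
  disc.
\<close>

lemma density_outside_closed:
  assumes x: "x \<ge> fs_radius (1 / \<alpha>)"
  defines "\<tau> \<equiv> \<lambda>x. exp (\<i> * of_real (pi * \<alpha> * \<rho>) - of_real \<alpha> * of_real (ln x))"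
  shows "\<psi> x = Im (\<tau> x * eval_fps (fs_fps \<alpha>) (\<tau> x)) / x" and "norm (\<tau> x) \<le> fs_radius \<alpha>"
proof -
  define R where "R = fs_radius (1 / \<alpha>)"
  have R: "R > 0" by (simp add: R_def fs_radius_pos)
  have norm_\<tau>: "norm (\<tau> y) \<le> fs_radius \<alpha>" if "y \<ge> R" for y
  proof -
    have "ln R \<le> ln y" using that R by simp
    then have "- (\<alpha> * ln y) \<le> ln (fs_radius \<alpha>)"
      using bounds(1) by (simp add: R_def ln_fs_radius_inverse field_simps)
    then have "exp (- (\<alpha> * ln y)) \<le> fs_radius \<alpha>"
      using fs_radius_pos[of \<alpha>] by (metis exp_le_cancel_iff exp_ln)
    then show ?thesis by (simp add: \<tau>_def)
  qed
  then show "norm (\<tau> x) \<le> fs_radius \<alpha>" using x by (simp add: R_def)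
  have c\<tau>: "continuous_on {R..} \<tau>"
    unfolding \<tau>_def using R by (intro continuous_intros) auto
  have "continuous_on {R..} (\<lambda>y. eval_fps (fs_fps \<alpha>) (\<tau> y))"
    using norm_\<tau> by (intro continuous_on_compose2[OF continuous_on_fs[OF bounds(1,2)] c\<tau>]) auto
  then have "continuous_on (closure {R<..}) (\<lambda>y. \<psi> y - Im (\<tau> y * eval_fps (fs_fps \<alpha>) (\<tau> y)) / y)"
    using c\<tau> continuous_on_subset[OF density_continuous] R
    by (auto intro!: continuous_intros simp: closure_greaterThan)
  moreover have "\<psi> y - Im (\<tau> y * eval_fps (fs_fps \<alpha>) (\<tau> y)) / y = 0" if "y \<in> {R<..}" for y
    using density_outside_open[of y] that by (simp add: R_def \<tau>_def)
  moreover have "x \<in> closure {R<..}"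
    using x by (simp add: R_def)
  ultimately have "\<psi> x - Im (\<tau> x * eval_fps (fs_fps \<alpha>) (\<tau> x)) / x = 0"
    by (rule continuous_constant_on_closure)
  then show "\<psi> x = Im (\<tau> x * eval_fps (fs_fps \<alpha>) (\<tau> x)) / x" by simp
qed

text \<open>
  Both end points of the interval are reached by continuity. The value at \<open>0\<close> is obtained only in this
  way, since \<open>ln x\<close> has no limit there.
\<close>

lemma density_inside_closed:
  assumes x: "0 \<le> x" "x \<le> fs_radius (1 / \<alpha>)"
  shows "\<psi> x = - Im (exp (- \<i> * of_real (pi * \<rho>)) *
           eval_fps (fs_fps (1 / \<alpha>)) (of_real x * exp (- \<i> * of_real (pi * \<rho>))))"
proof -
  define R where "R = fs_radius (1 / \<alpha>)"
  have R: "R > 0" by (simp add: R_def fs_radius_pos)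
  define w where "w = exp (- \<i> * of_real (pi * \<rho>))"
  have w: "norm w = 1" by (simp add: w_def)
  have c: "1 / \<alpha> > 0" "1 / \<alpha> \<noteq> 1" using bounds by auto
  have cl: "closure {0<..<R} = {0..R}" using R by simp
  have "continuous_on {0..R} (\<lambda>y. eval_fps (fs_fps (1 / \<alpha>)) (of_real y * w))"
    by (intro continuous_on_compose2[OF continuous_on_fs[OF c]] continuous_intros)
       (auto simp: norm_mult w R_def)
  then have "continuous_on (closure {0<..<R}) (\<lambda>y. \<psi> y + Im (w * eval_fps (fs_fps (1 / \<alpha>)) (of_real y * w)))"
    unfolding cl
    by (intro continuous_on_add continuous_on_Im continuous_on_mult continuous_on_const continuous_on_subset[OF density_continuous]) auto
  moreover have "\<psi> y + Im (w * eval_fps (fs_fps (1 / \<alpha>)) (of_real y * w)) = 0" if "y \<in> {0<..<R}" for y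
  proof -
    have "exp (of_real (ln y) - \<i> * of_real (pi * \<rho>)) = of_real y * w"
      using that by (simp add: w_def exp_diff exp_minus exp_of_real divide_inverse)
    then show ?thesis
      using density_inside_open[of y] that by (simp add: R_def w_def)
  qed
  moreover have "x \<in> closure {0<..<R}"
    unfolding cl using x by (simp add: R_def)
  ultimately have "\<psi> x + Im (w * eval_fps (fs_fps (1 / \<alpha>)) (of_real x * w)) = 0"
    by (rule continuous_constant_on_closure)
  then show ?thesis unfolding w_def by linarith
qed

lemma density_outside_sums:
  assumes x: "x \<ge> fs_radius (1 / \<alpha>)"
  shows "(\<lambda>k. fs_coeff \<alpha> (Suc k) * sin (real (Suc k) * \<alpha> * \<rho> * pi) * x powr (- \<alpha> * real (Suc k) - 1))
           sums \<psi> x"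
proof -
  have x0: "x > 0" using x fs_radius_pos[of "1 / \<alpha>"] by linarith
  define \<tau> where "\<tau> = exp (\<i> * of_real (pi * \<alpha> * \<rho>) - of_real \<alpha> * of_real (ln x))"
  have "(\<lambda>k. \<tau> * (of_real (fs_coeff \<alpha> (Suc k)) * \<tau> ^ k)) sums (\<tau> * eval_fps (fs_fps \<alpha>) \<tau>)"
    using density_outside_closed(2)[OF x] unfolding \<tau>_def
    by (intro sums_mult fs_fps_sums bounds)
  then have "(\<lambda>k. Im (\<tau> * (of_real (fs_coeff \<alpha> (Suc k)) * \<tau> ^ k)) / x)
      sums (Im (\<tau> * eval_fps (fs_fps \<alpha>) \<tau>) / x)"
    by (intro sums_divide sums_Im)
  also have "Im (\<tau> * eval_fps (fs_fps \<alpha>) \<tau>) / x = \<psi> x"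
    using density_outside_closed(1)[OF x] by (simp add: \<tau>_def)
  finally have sums: "(\<lambda>k. Im (\<tau> * (of_real (fs_coeff \<alpha> (Suc k)) * \<tau> ^ k)) / x) sums \<psi> x" .
  have coeff: "Im (\<tau> * (of_real (fs_coeff \<alpha> (Suc k)) * \<tau> ^ k)) / x
      = fs_coeff \<alpha> (Suc k) * sin (real (Suc k) * \<alpha> * \<rho> * pi) * x powr (- \<alpha> * real (Suc k) - 1)" for k
  proof -
    have "\<tau> * (of_real (fs_coeff \<alpha> (Suc k)) * \<tau> ^ k) = of_real (fs_coeff \<alpha> (Suc k)) * \<tau> ^ Suc k"
      by simp
    then have "Im (\<tau> * (of_real (fs_coeff \<alpha> (Suc k)) * \<tau> ^ k)) = fs_coeff \<alpha> (Suc k) * Im (\<tau> ^ Suc k)"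
      by (simp only: Im_of_real_mult)
    also have "\<tau> ^ Suc k = exp (of_nat (Suc k) * (\<i> * of_real (pi * \<alpha> * \<rho>) - of_real \<alpha> * of_real (ln x)))"
      unfolding \<tau>_def by (simp only: exp_of_nat_mult)
    also have "Im \<dots> = exp (- \<alpha> * real (Suc k) * ln x) * sin (real (Suc k) * \<alpha> * \<rho> * pi)"
      by (simp add: Im_exp algebra_simps)
    also have "exp (- \<alpha> * real (Suc k) * ln x) = x powr (- \<alpha> * real (Suc k) - 1) * x"
      using x0 by (simp add: powr_def left_diff_distrib exp_diff)
    finally show ?thesis using x0 by simp
  qed
  show ?thesis using sums unfolding coeff .
qed

lemma density_inside_sums:
  assumes x: "0 \<le> x" "x \<le> fs_radius (1 / \<alpha>)"
  shows "(\<lambda>k. fs_coeff (1 / \<alpha>) (Suc k) * sin (real (Suc k) * \<rho> * pi) * x ^ k) sums \<psi> x"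
proof -
  define w where "w = exp (- \<i> * of_real (pi * \<rho>))"
  have c: "1 / \<alpha> > 0" "1 / \<alpha> \<noteq> 1" using bounds by auto
  have "norm (of_real x * w) \<le> fs_radius (1 / \<alpha>)"
    using x by (simp add: w_def norm_mult)
  then have "(\<lambda>k. w * (of_real (fs_coeff (1 / \<alpha>) (Suc k)) * (of_real x * w) ^ k))
      sums (w * eval_fps (fs_fps (1 / \<alpha>)) (of_real x * w))"
    by (intro sums_mult fs_fps_sums c)
  then have "(\<lambda>k. - Im (w * (of_real (fs_coeff (1 / \<alpha>) (Suc k)) * (of_real x * w) ^ k)))
      sums (- Im (w * eval_fps (fs_fps (1 / \<alpha>)) (of_real x * w)))"
    by (intro sums_minus sums_Im)
  also have "- Im (w * eval_fps (fs_fps (1 / \<alpha>)) (of_real x * w)) = \<psi> x"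
    using density_inside_closed[OF x] by (simp add: w_def)
  finally have sums: "(\<lambda>k. - Im (w * (of_real (fs_coeff (1 / \<alpha>) (Suc k)) * (of_real x * w) ^ k))) sums \<psi> x" .
  have coeff: "- Im (w * (of_real (fs_coeff (1 / \<alpha>) (Suc k)) * (of_real x * w) ^ k))
      = fs_coeff (1 / \<alpha>) (Suc k) * sin (real (Suc k) * \<rho> * pi) * x ^ k" for k
  proof -
    have "w * (of_real (fs_coeff (1 / \<alpha>) (Suc k)) * (of_real x * w) ^ k)
        = of_real (fs_coeff (1 / \<alpha>) (Suc k) * x ^ k) * w ^ Suc k"
      by (simp add: power_mult_distrib mult_ac)
    then have "Im (w * (of_real (fs_coeff (1 / \<alpha>) (Suc k)) * (of_real x * w) ^ k))
        = fs_coeff (1 / \<alpha>) (Suc k) * x ^ k * Im (w ^ Suc k)"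
      by (simp only: Im_of_real_mult)
    also have "w ^ Suc k = exp (of_nat (Suc k) * (- \<i> * of_real (pi * \<rho>)))"
      unfolding w_def by (simp only: exp_of_nat_mult)
    also have "Im \<dots> = - sin (real (Suc k) * \<rho> * pi)"
      by (simp add: Im_exp algebra_simps flip: sin_minus)
    finally show ?thesis by simp
  qed
  show ?thesis using sums unfolding coeff .
qed

lemma cauchy_transform_reflect:
  assumes "Im z > 0"
  shows "cauchy_transform (distr \<nu> borel uminus) z = - cnj (cauchy_transform \<nu> (- cnj z))"
proof -
  have [measurable_cong]: "sets \<nu> = sets borel" by (rule free_stable_sets[OF adm stable])
  have "cauchy_transform (distr \<nu> borel uminus) z = (\<integral>x. 1 / (z - of_real (- x)) \<partial>\<nu>)"
    unfolding cauchy_transform_def by (rule integral_distr) measurable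
  also have "\<dots> = (\<integral>x. - cnj (1 / (- cnj z - of_real x)) \<partial>\<nu>)"
  proof (rule Bochner_Integration.integral_cong)
    fix x
    have "- cnj (- cnj z - of_real x) = z - of_real (- x)" by simp
    then show "1 / (z - of_real (- x)) = - cnj (1 / (- cnj z - of_real x))"
      by (metis complex_cnj_divide complex_cnj_one divide_minus_right)
  qed simp
  also have "\<dots> = - cnj (cauchy_transform \<nu> (- cnj z))"
    unfolding cauchy_transform_def
    by (simp only: Bochner_Integration.integral_minus Bochner_Integration.integral_cnj)
  finally show ?thesis .
qed

text \<open>
  Reflection in the imaginary axis sends \<open>u\<close> to \<open>- cnj u\<close>, whose logarithm is \<open>\<i> * \<pi> + cnj (Ln u)\<close>. The
  extra phase \<open>\<pi> * (1 - \<alpha>)\<close> in the power is exactly what turns \<open>\<rho>\<close> into \<open>1 - \<rho>\<close>.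
\<close>

lemma is_free_stable_reflect: "is_free_stable \<alpha> (1 - \<rho>) (distr \<nu> borel uminus)"
proof -
  interpret prob_space \<nu> by (rule free_stable_prob_space[OF adm stable])
  have [measurable_cong]: "sets \<nu> = sets borel" by (rule free_stable_sets[OF adm stable])
  have "z = 1 / cauchy_transform (distr \<nu> borel uminus) z +
            free_stable_phi \<alpha> (1 - \<rho>) (1 / cauchy_transform (distr \<nu> borel uminus) z)"
    if z: "Im z > 0" for z
  proof -
    define u where "u = 1 / cauchy_transform \<nu> (- cnj z)"
    have zz: "Im (- cnj z) > 0" using z by simp
    have G: "1 / cauchy_transform (distr \<nu> borel uminus) z = - cnj u"
      using cauchy_transform_reflect[OF z] by (simp add: u_def)
    have eq: "- cnj z = u + free_stable_phi \<alpha> \<rho> u"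
      using stable zz unfolding is_free_stable_def has_voiculescu_transform_def u_def by blast
    have "Im (cauchy_transform \<nu> (- cnj z)) < 0"
      using zz by (intro Im_cauchy_transform_neg free_stable_prob_space[OF adm stable] free_stable_sets[OF adm stable])
    then have u: "Im u > 0"
      unfolding u_def by (simp add: Im_divide divide_neg_pos add_nonneg_pos)
    then have u0: "u \<noteq> 0" by auto
    have arg: "0 < Im (Ln u)" "Im (Ln u) < pi" using Im_Ln_pos_lt_imp[OF u] by auto
    have Ln: "Ln (- cnj u) = \<i> * of_real pi + cnj (Ln u)"
    proof (rule Ln_unique)
      show "exp (\<i> * of_real pi + cnj (Ln u)) = - cnj u"
        using u0 by (simp add: exp_add flip: exp_cnj)
    qed (use arg in auto)
    have "free_stable_phi \<alpha> (1 - \<rho>) (- cnj u)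
        = - exp (of_real pi * \<i> * of_real \<alpha> * of_real (1 - \<rho>) + of_real (- \<alpha> + 1) * (\<i> * of_real pi + cnj (Ln u)))"
      using u0 by (simp add: free_stable_phi_def powr_def Ln exp_add)
    also have "of_real pi * \<i> * of_real \<alpha> * of_real (1 - \<rho>) + of_real (- \<alpha> + 1) * (\<i> * of_real pi + cnj (Ln u))
        = \<i> * of_real pi + cnj (of_real pi * \<i> * of_real \<alpha> * of_real \<rho> + of_real (- \<alpha> + 1) * Ln u)"
      by (simp add: algebra_simps)
    also have "- exp \<dots> = cnj (exp (of_real pi * \<i> * of_real \<alpha> * of_real \<rho> + of_real (- \<alpha> + 1) * Ln u))"
      unfolding exp_add[of "\<i> * of_real pi"] exp_cnj by (simp add: mult.commute)
    also have "exp (of_real pi * \<i> * of_real \<alpha> * of_real \<rho> + of_real (- \<alpha> + 1) * Ln u)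
        = - free_stable_phi \<alpha> \<rho> u"
      using u0 by (simp add: free_stable_phi_def powr_def exp_add)
    finally have "- cnj u + free_stable_phi \<alpha> (1 - \<rho>) (- cnj u) = - cnj (u + free_stable_phi \<alpha> \<rho> u)"
      by simp
    also have "\<dots> = z" unfolding eq[symmetric] by simp
    finally show ?thesis unfolding G by simp
  qed
  then show ?thesis
    unfolding is_free_stable_def has_voiculescu_transform_def
    by (auto intro: prob_space_distr)
qed

lemma is_continuous_density_reflect:
  "is_continuous_density (distr \<nu> borel uminus) (\<lambda>x. \<psi> (- x))"
proof -
  have [measurable]: "\<psi> \<in> borel_measurable borel"
    using density_continuous by (rule borel_measurable_continuous_onI)
  have nonneg: "\<And>x. 0 \<le> \<psi> x" and \<nu>_eq: "\<nu> = density lborel (\<lambda>x. ennreal (\<psi> x))"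
    using dens by (auto simp: is_continuous_density_def)
  have "density (distr lborel borel uminus) (\<lambda>x. ennreal (\<psi> (- x)))
      = distr (density lborel (\<lambda>x. ennreal (\<psi> (- (- x))))) borel uminus"
    by (rule density_distr) measurable
  then have "distr \<nu> borel uminus = density lborel (\<lambda>x. ennreal (\<psi> (- x)))"
    by (simp add: \<nu>_eq lborel_distr_uminus)
  moreover have "continuous_on UNIV (\<lambda>x. \<psi> (- x))"
    by (intro continuous_on_compose2[OF density_continuous] continuous_intros) auto
  ultimately show ?thesis
    using nonneg by (simp add: is_continuous_density_def)
qed

end

text \<open>
  The series depend on the parameters only, so the functional equation determines the density on
  \<open>[0, \<infinity>)\<close>; by reflection it does so on the whole line, which gives the symmetry in \<open>density_reflect\<close>.
\<close>

lemma density_unique_nonneg: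
  assumes "(\<alpha>, \<rho>) \<in> admissible_params" and "x \<ge> 0"
    and "is_free_stable \<alpha> \<rho> \<nu>\<^sub>1" "is_continuous_density \<nu>\<^sub>1 \<psi>\<^sub>1"
    and "is_free_stable \<alpha> \<rho> \<nu>\<^sub>2" "is_continuous_density \<nu>\<^sub>2 \<psi>\<^sub>2"
  shows "\<psi>\<^sub>1 x = \<psi>\<^sub>2 x"
proof (cases "x \<ge> fs_radius (1 / \<alpha>)")
  case True
  then show ?thesis
    using density_outside_sums[OF assms(1,3,4)] density_outside_sums[OF assms(1,5,6)]
    by (blast intro: sums_unique2)
next
  case False
  then have "x \<le> fs_radius (1 / \<alpha>)" by simp
  then show ?thesis
    using density_inside_sums[OF assms(1,3,4,2)] density_inside_sums[OF assms(1,5,6,2)]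
    by (blast intro: sums_unique2)
qed

lemma admissible_reflect:
  "(\<alpha>, \<rho>) \<in> admissible_params \<Longrightarrow> (\<alpha>, 1 - \<rho>) \<in> admissible_params"
  by (auto simp: admissible_params_def)

lemma admissible_dual:
  assumes "1 < \<alpha>" "\<alpha> \<le> 2" "1 - 1 / \<alpha> \<le> \<rho>" "\<rho> \<le> 1 / \<alpha>"
  shows "(\<alpha>, \<rho>) \<in> admissible_params" "(1 / \<alpha>, \<alpha> * \<rho>) \<in> admissible_params"
proof -
  show adm: "(\<alpha>, \<rho>) \<in> admissible_params"
    using assms by (simp add: admissible_params_def)
  show "(1 / \<alpha>, \<alpha> * \<rho>) \<in> admissible_params"
    using admissible_bounds[OF adm] assms by (simp add: admissible_params_def)
qed

lemma density_reflect:
  assumes adm: "(\<alpha>, \<rho>) \<in> admissible_params"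
    and 1: "is_free_stable \<alpha> \<rho> \<nu>\<^sub>1" "is_continuous_density \<nu>\<^sub>1 \<psi>\<^sub>1"
    and 2: "is_free_stable \<alpha> (1 - \<rho>) \<nu>\<^sub>2" "is_continuous_density \<nu>\<^sub>2 \<psi>\<^sub>2"
  shows "\<psi>\<^sub>1 x = \<psi>\<^sub>2 (- x)"
proof (cases "x \<ge> 0")
  case True
  note adm' = admissible_reflect[OF adm]
  have "is_free_stable \<alpha> \<rho> (distr \<nu>\<^sub>2 borel uminus)"
    using is_free_stable_reflect[OF adm' 2] by simp
  from density_unique_nonneg[OF adm True 1 this is_continuous_density_reflect[OF adm' 2]]
  show ?thesis .
next
  case False
  then have "- x \<ge> 0" by simp
  from density_unique_nonneg[OF admissible_reflect[OF adm] this 2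
        is_free_stable_reflect[OF adm 1] is_continuous_density_reflect[OF adm 1]]
  show ?thesis by simp
qed

text \<open>
  The substitution \<open>y = x powr (- \<alpha>)\<close> carries the expansion at infinity for \<open>(\<alpha>, \<rho>)\<close> term by term into
  the expansion at zero for \<open>(1 / \<alpha>, \<alpha> * \<rho>)\<close>, and vice versa; their domains correspond as well.
\<close>

lemma density_dual:
  assumes \<alpha>: "1 < \<alpha>" "\<alpha> \<le> 2" "1 - 1 / \<alpha> \<le> \<rho>" "\<rho> \<le> 1 / \<alpha>" and x: "x > 0"
    and 1: "is_free_stable \<alpha> \<rho> \<nu>\<^sub>1" "is_continuous_density \<nu>\<^sub>1 \<psi>\<^sub>1"
    and 2: "is_free_stable (1 / \<alpha>) (\<alpha> * \<rho>) \<nu>\<^sub>2" "is_continuous_density \<nu>\<^sub>2 \<psi>\<^sub>2"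
  shows "\<psi>\<^sub>1 x = x powr (- \<alpha> - 1) * \<psi>\<^sub>2 (x powr (- \<alpha>))"
proof -
  note adm = admissible_dual[OF \<alpha>]
  have ln_radius: "ln (fs_radius (1 / \<alpha>)) = - ln (fs_radius \<alpha>) / \<alpha>"
    using \<alpha> by (intro ln_fs_radius_inverse) simp
  have flip: "x powr (- \<alpha>) \<le> fs_radius \<alpha> \<longleftrightarrow> fs_radius (1 / \<alpha>) \<le> x"
  proof -
    have "x powr (- \<alpha>) \<le> fs_radius \<alpha> \<longleftrightarrow> ln (x powr (- \<alpha>)) \<le> ln (fs_radius \<alpha>)"
      using x fs_radius_pos[of \<alpha>] by (intro ln_le_cancel_iff[symmetric]) auto
    also have "\<dots> \<longleftrightarrow> ln (fs_radius (1 / \<alpha>)) \<le> ln x"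
      unfolding ln_radius using x \<alpha> by (simp add: ln_powr field_simps) auto
    also have "\<dots> \<longleftrightarrow> fs_radius (1 / \<alpha>) \<le> x"
      using x fs_radius_pos[of "1 / \<alpha>"] by simp
    finally show ?thesis .
  qed
  show ?thesis
  proof (cases "fs_radius (1 / \<alpha>) \<le> x")
    case True
    have "(\<lambda>k. x powr (- \<alpha> - 1) * (fs_coeff (1 / (1 / \<alpha>)) (Suc k) * sin (real (Suc k) * (\<alpha> * \<rho>) * pi)
              * (x powr (- \<alpha>)) ^ k)) sums (x powr (- \<alpha> - 1) * \<psi>\<^sub>2 (x powr (- \<alpha>)))"
      using True flip by (intro sums_mult density_inside_sums[OF adm(2) 2]) auto
    also have "(\<lambda>k. x powr (- \<alpha> - 1) * (fs_coeff (1 / (1 / \<alpha>)) (Suc k) * sin (real (Suc k) * (\<alpha> * \<rho>) * pi)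
              * (x powr (- \<alpha>)) ^ k))
       = (\<lambda>k. fs_coeff \<alpha> (Suc k) * sin (real (Suc k) * \<alpha> * \<rho> * pi) * x powr (- \<alpha> * real (Suc k) - 1))"
    proof
      fix k
      have "x powr (- \<alpha> - 1) * (x powr (- \<alpha>)) ^ k = x powr (- \<alpha> * real (Suc k) - 1)"
        using x by (simp add: powr_powr algebra_simps flip: powr_realpow powr_add)
      then show "x powr (- \<alpha> - 1) * (fs_coeff (1 / (1 / \<alpha>)) (Suc k) * sin (real (Suc k) * (\<alpha> * \<rho>) * pi)
              * (x powr (- \<alpha>)) ^ k)
        = fs_coeff \<alpha> (Suc k) * sin (real (Suc k) * \<alpha> * \<rho> * pi) * x powr (- \<alpha> * real (Suc k) - 1)"
        by (simp add: mult_ac)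
    qed
    finally show ?thesis
      using density_outside_sums[OF adm(1) 1 True] by (rule sums_unique2[rotated])
  next
    case False
    have "x powr (- \<alpha>) \<ge> fs_radius (1 / (1 / \<alpha>))" using False flip by auto
    then have "(\<lambda>k. x powr (- \<alpha> - 1) * (fs_coeff (1 / \<alpha>) (Suc k) * sin (real (Suc k) * (1 / \<alpha>) * (\<alpha> * \<rho>) * pi)
              * (x powr (- \<alpha>)) powr (- (1 / \<alpha>) * real (Suc k) - 1))) sums (x powr (- \<alpha> - 1) * \<psi>\<^sub>2 (x powr (- \<alpha>)))"
      by (intro sums_mult density_outside_sums[OF adm(2) 2])
    also have "(\<lambda>k. x powr (- \<alpha> - 1) * (fs_coeff (1 / \<alpha>) (Suc k) * sin (real (Suc k) * (1 / \<alpha>) * (\<alpha> * \<rho>) * pi)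
              * (x powr (- \<alpha>)) powr (- (1 / \<alpha>) * real (Suc k) - 1)))
       = (\<lambda>k. fs_coeff (1 / \<alpha>) (Suc k) * sin (real (Suc k) * \<rho> * pi) * x ^ k)"
    proof
      fix k
      have "- \<alpha> - 1 + - \<alpha> * (- (1 / \<alpha>) * real (Suc k) - 1) = real k"
        using \<alpha> by (simp add: field_simps)
      then have pow: "x powr (- \<alpha> - 1) * (x powr (- \<alpha>)) powr (- (1 / \<alpha>) * real (Suc k) - 1) = x ^ k"
        using x by (simp only: powr_powr powr_add[symmetric] powr_realpow)
      have "real (Suc k) * (1 / \<alpha>) * (\<alpha> * \<rho>) * pi = real (Suc k) * \<rho> * pi"
        using \<alpha> by simp
      then show "x powr (- \<alpha> - 1) * (fs_coeff (1 / \<alpha>) (Suc k) * sin (real (Suc k) * (1 / \<alpha>) * (\<alpha> * \<rho>) * pi)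
              * (x powr (- \<alpha>)) powr (- (1 / \<alpha>) * real (Suc k) - 1))
        = fs_coeff (1 / \<alpha>) (Suc k) * sin (real (Suc k) * \<rho> * pi) * x ^ k"
        unfolding pow[symmetric] by (simp only: mult_ac)
    qed
    finally show ?thesis
      using density_inside_sums[OF adm(1) 1, of x] False x by (intro sums_unique2[rotated]) auto
  qed
qed

theorem theorem2:
  fixes \<nu> :: "real \<Rightarrow> real \<Rightarrow> real measure"
    and \<psi> :: "real \<Rightarrow> real \<Rightarrow> real \<Rightarrow> real"
  assumes \<nu>: "\<And>\<alpha> \<rho>. (\<alpha>, \<rho>) \<in> admissible_params \<Longrightarrow> is_free_stable \<alpha> \<rho> (\<nu> \<alpha> \<rho>)"
    and \<psi>: "\<And>\<alpha> \<rho>. (\<alpha>, \<rho>) \<in> admissible_params \<Longrightarrow> is_continuous_density (\<nu> \<alpha> \<rho>) (\<psi> \<alpha> \<rho>)"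
  shows
    "(\<forall>\<alpha> \<rho>. 0 < \<alpha> \<and> \<alpha> < 1 \<and> 0 \<le> \<rho> \<and> \<rho> \<le> 1 \<longrightarrow>
        (\<forall>x \<ge> x_star \<alpha>.
           sums_from_1 (\<lambda>n. fs_coeff \<alpha> n * sin (real n * \<alpha> * \<rho> * pi) * x powr (- \<alpha> * real n - 1))
             (\<psi> \<alpha> \<rho> x)) \<and>
        (\<forall>x. 0 \<le> x \<and> x \<le> x_star \<alpha> \<longrightarrow>
           sums_from_1 (\<lambda>n. fs_coeff (1 / \<alpha>) n * sin (real n * \<rho> * pi) * x ^ (n - 1))
             (\<psi> \<alpha> \<rho> x)) \<and>
        (\<forall>x < 0. - x \<ge> x_star \<alpha> \<longrightarrow>
           sums_from_1 (\<lambda>n. fs_coeff \<alpha> n * sin (real n * \<alpha> * (1 - \<rho>) * pi) * (- x) powr (- \<alpha> * real n - 1))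
             (\<psi> \<alpha> \<rho> x)) \<and>
        (\<forall>x < 0. - x \<le> x_star \<alpha> \<longrightarrow>
           sums_from_1 (\<lambda>n. fs_coeff (1 / \<alpha>) n * sin (real n * (1 - \<rho>) * pi) * (- x) ^ (n - 1))
             (\<psi> \<alpha> \<rho> x)))
   \<and> (\<forall>\<alpha> \<rho>. 1 < \<alpha> \<and> \<alpha> \<le> 2 \<and> 1 - 1 / \<alpha> \<le> \<rho> \<and> \<rho> \<le> 1 / \<alpha> \<longrightarrow>
        (\<forall>y \<ge> y_star \<alpha>.
           sums_from_1 (\<lambda>n. fs_coeff (1 / \<alpha>) n * sin (real n * \<rho> * pi) * y powr (- real n / \<alpha> - 1))
             (\<psi> (1 / \<alpha>) (\<alpha> * \<rho>) y)) \<and>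
        (\<forall>y. 0 \<le> y \<and> y \<le> y_star \<alpha> \<longrightarrow>
           sums_from_1 (\<lambda>n. fs_coeff \<alpha> n * sin (real n * \<alpha> * \<rho> * pi) * y ^ (n - 1))
             (\<psi> (1 / \<alpha>) (\<alpha> * \<rho>) y)) \<and>
        (\<forall>x > 0. \<psi> \<alpha> \<rho> x = x powr (- \<alpha> - 1) * \<psi> (1 / \<alpha>) (\<alpha> * \<rho>) (x powr (- \<alpha>))) \<and>
        (\<forall>x > 0. x powr (- \<alpha>) \<ge> y_star \<alpha> \<longrightarrow>
           sums_from_1 (\<lambda>n. x powr (- \<alpha> - 1) *
               (fs_coeff (1 / \<alpha>) n * sin (real n * \<rho> * pi) * (x powr (- \<alpha>)) powr (- real n / \<alpha> - 1)))
             (\<psi> \<alpha> \<rho> x)) \<and>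
        (\<forall>x > 0. x powr (- \<alpha>) \<le> y_star \<alpha> \<longrightarrow>
           sums_from_1 (\<lambda>n. x powr (- \<alpha> - 1) *
               (fs_coeff \<alpha> n * sin (real n * \<alpha> * \<rho> * pi) * (x powr (- \<alpha>)) ^ (n - 1)))
             (\<psi> \<alpha> \<rho> x)) \<and>
        (\<forall>x < 0. (- x) powr (- \<alpha>) \<ge> y_star \<alpha> \<longrightarrow>
           sums_from_1 (\<lambda>n. (- x) powr (- \<alpha> - 1) *
               (fs_coeff (1 / \<alpha>) n * sin (real n * (1 - \<rho>) * pi) * ((- x) powr (- \<alpha>)) powr (- real n / \<alpha> - 1)))
             (\<psi> \<alpha> \<rho> x)) \<and>
        (\<forall>x < 0. (- x) powr (- \<alpha>) \<le> y_star \<alpha> \<longrightarrow>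
           sums_from_1 (\<lambda>n. (- x) powr (- \<alpha> - 1) *
               (fs_coeff \<alpha> n * sin (real n * \<alpha> * (1 - \<rho>) * pi) * ((- x) powr (- \<alpha>)) ^ (n - 1)))
             (\<psi> \<alpha> \<rho> x)))
   \<and> (\<forall>\<alpha> \<rho>. (\<alpha>, \<rho>) \<in> admissible_params \<longrightarrow> (\<forall>x. \<psi> \<alpha> \<rho> x = \<psi> \<alpha> (1 - \<rho>) (- x)))"
proof -
  have outside: "sums_from_1 (\<lambda>n. fs_coeff \<alpha> n * sin (real n * \<alpha> * \<rho> * pi) * x powr (- \<alpha> * real n - 1)) (\<psi> \<alpha> \<rho> x)"
    if "(\<alpha>, \<rho>) \<in> admissible_params" "x \<ge> fs_radius (1 / \<alpha>)" for \<alpha> \<rho> x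
    using density_outside_sums[OF that(1) \<nu>[OF that(1)] \<psi>[OF that(1)] that(2)] .
  have inside: "sums_from_1 (\<lambda>n. fs_coeff (1 / \<alpha>) n * sin (real n * \<rho> * pi) * x ^ (n - 1)) (\<psi> \<alpha> \<rho> x)"
    if "(\<alpha>, \<rho>) \<in> admissible_params" "0 \<le> x" "x \<le> fs_radius (1 / \<alpha>)" for \<alpha> \<rho> x
    using density_inside_sums[OF that(1) \<nu>[OF that(1)] \<psi>[OF that(1)] that(2,3)] by simp
  have reflect: "\<psi> \<alpha> \<rho> x = \<psi> \<alpha> (1 - \<rho>) (- x)" if "(\<alpha>, \<rho>) \<in> admissible_params" for \<alpha> \<rho> x
    using density_reflect[OF that \<nu>[OF that] \<psi>[OF that]] \<nu> \<psi> admissible_reflect[OF that] by blast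

  have small_alpha:
    "(\<forall>x \<ge> x_star \<alpha>.
       sums_from_1 (\<lambda>n. fs_coeff \<alpha> n * sin (real n * \<alpha> * \<rho> * pi) * x powr (- \<alpha> * real n - 1)) (\<psi> \<alpha> \<rho> x)) \<and>
     (\<forall>x. 0 \<le> x \<and> x \<le> x_star \<alpha> \<longrightarrow>
       sums_from_1 (\<lambda>n. fs_coeff (1 / \<alpha>) n * sin (real n * \<rho> * pi) * x ^ (n - 1)) (\<psi> \<alpha> \<rho> x)) \<and>
     (\<forall>x < 0. - x \<ge> x_star \<alpha> \<longrightarrow>
       sums_from_1 (\<lambda>n. fs_coeff \<alpha> n * sin (real n * \<alpha> * (1 - \<rho>) * pi) * (- x) powr (- \<alpha> * real n - 1))
         (\<psi> \<alpha> \<rho> x)) \<and>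
     (\<forall>x < 0. - x \<le> x_star \<alpha> \<longrightarrow>
       sums_from_1 (\<lambda>n. fs_coeff (1 / \<alpha>) n * sin (real n * (1 - \<rho>) * pi) * (- x) ^ (n - 1)) (\<psi> \<alpha> \<rho> x))"
    if \<alpha>: "0 < \<alpha> \<and> \<alpha> < 1 \<and> 0 \<le> \<rho> \<and> \<rho> \<le> 1" for \<alpha> \<rho>
  proof -
    have adm: "(\<alpha>, \<rho>) \<in> admissible_params" using \<alpha> by (simp add: admissible_params_def)
    note adm' = admissible_reflect[OF adm]
    have radius: "x_star \<alpha> = fs_radius (1 / \<alpha>)" using \<alpha> by (intro x_star_eq) auto
    show ?thesis
      unfolding radius
    proof (intro conjI allI impI)
      fix x assume "x \<ge> fs_radius (1 / \<alpha>)"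
      then show "sums_from_1 (\<lambda>n. fs_coeff \<alpha> n * sin (real n * \<alpha> * \<rho> * pi) * x powr (- \<alpha> * real n - 1)) (\<psi> \<alpha> \<rho> x)"
        by (rule outside[OF adm])
    next
      fix x assume "0 \<le> x \<and> x \<le> fs_radius (1 / \<alpha>)"
      then show "sums_from_1 (\<lambda>n. fs_coeff (1 / \<alpha>) n * sin (real n * \<rho> * pi) * x ^ (n - 1)) (\<psi> \<alpha> \<rho> x)"
        by (intro inside[OF adm]) auto
    next
      fix x :: real assume "x < 0" "- x \<ge> fs_radius (1 / \<alpha>)"
      then show "sums_from_1 (\<lambda>n. fs_coeff \<alpha> n * sin (real n * \<alpha> * (1 - \<rho>) * pi) * (- x) powr (- \<alpha> * real n - 1)) (\<psi> \<alpha> \<rho> x)"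
        unfolding reflect[OF adm, of x] by (intro outside[OF adm'])
    next
      fix x :: real assume "x < 0" "- x \<le> fs_radius (1 / \<alpha>)"
      then show "sums_from_1 (\<lambda>n. fs_coeff (1 / \<alpha>) n * sin (real n * (1 - \<rho>) * pi) * (- x) ^ (n - 1)) (\<psi> \<alpha> \<rho> x)"
        unfolding reflect[OF adm, of x] by (intro inside[OF adm']) auto
    qed
  qed

  have dual_outside: "sums_from_1 (\<lambda>n. fs_coeff (1 / \<alpha>) n * sin (real n * \<rho> * pi) * y powr (- real n / \<alpha> - 1))
             (\<psi> (1 / \<alpha>) (\<alpha> * \<rho>) y)"
    if \<alpha>: "1 < \<alpha>" "\<alpha> \<le> 2" "1 - 1 / \<alpha> \<le> \<rho>" "\<rho> \<le> 1 / \<alpha>" and y: "y \<ge> y_star \<alpha>" for \<alpha> \<rho> y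
  proof -
    have "y \<ge> fs_radius (1 / (1 / \<alpha>))" using y \<alpha> by (simp add: y_star_eq)
    moreover have "real n * (1 / \<alpha>) * (\<alpha> * \<rho>) * pi = real n * \<rho> * pi"
      "- (1 / \<alpha>) * real n - 1 = - real n / \<alpha> - 1" for n
      using \<alpha> by auto
    ultimately show ?thesis
      using outside[OF admissible_dual(2)[OF \<alpha>], of y] by (simp only:)
  qed
  have dual_inside: "sums_from_1 (\<lambda>n. fs_coeff \<alpha> n * sin (real n * \<alpha> * \<rho> * pi) * y ^ (n - 1))
             (\<psi> (1 / \<alpha>) (\<alpha> * \<rho>) y)"
    if \<alpha>: "1 < \<alpha>" "\<alpha> \<le> 2" "1 - 1 / \<alpha> \<le> \<rho>" "\<rho> \<le> 1 / \<alpha>" and y: "0 \<le> y" "y \<le> y_star \<alpha>" for \<alpha> \<rho> y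
    using inside[OF admissible_dual(2)[OF \<alpha>], of y] y \<alpha> by (simp add: y_star_eq mult.assoc)
  have dual: "\<psi> \<alpha> \<rho> x = x powr (- \<alpha> - 1) * \<psi> (1 / \<alpha>) (\<alpha> * \<rho>) (x powr (- \<alpha>))"
    if \<alpha>: "1 < \<alpha>" "\<alpha> \<le> 2" "1 - 1 / \<alpha> \<le> \<rho>" "\<rho> \<le> 1 / \<alpha>" and x: "x > 0" for \<alpha> \<rho> x
    using density_dual[OF \<alpha> x] \<nu> \<psi> admissible_dual[OF \<alpha>] by blast

  have large_alpha:
    "(\<forall>y \<ge> y_star \<alpha>.
       sums_from_1 (\<lambda>n. fs_coeff (1 / \<alpha>) n * sin (real n * \<rho> * pi) * y powr (- real n / \<alpha> - 1))
         (\<psi> (1 / \<alpha>) (\<alpha> * \<rho>) y)) \<and>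
     (\<forall>y. 0 \<le> y \<and> y \<le> y_star \<alpha> \<longrightarrow>
       sums_from_1 (\<lambda>n. fs_coeff \<alpha> n * sin (real n * \<alpha> * \<rho> * pi) * y ^ (n - 1))
         (\<psi> (1 / \<alpha>) (\<alpha> * \<rho>) y)) \<and>
     (\<forall>x > 0. \<psi> \<alpha> \<rho> x = x powr (- \<alpha> - 1) * \<psi> (1 / \<alpha>) (\<alpha> * \<rho>) (x powr (- \<alpha>))) \<and>
     (\<forall>x > 0. x powr (- \<alpha>) \<ge> y_star \<alpha> \<longrightarrow>
       sums_from_1 (\<lambda>n. x powr (- \<alpha> - 1) *
           (fs_coeff (1 / \<alpha>) n * sin (real n * \<rho> * pi) * (x powr (- \<alpha>)) powr (- real n / \<alpha> - 1)))
         (\<psi> \<alpha> \<rho> x)) \<and>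
     (\<forall>x > 0. x powr (- \<alpha>) \<le> y_star \<alpha> \<longrightarrow>
       sums_from_1 (\<lambda>n. x powr (- \<alpha> - 1) *
           (fs_coeff \<alpha> n * sin (real n * \<alpha> * \<rho> * pi) * (x powr (- \<alpha>)) ^ (n - 1)))
         (\<psi> \<alpha> \<rho> x)) \<and>
     (\<forall>x < 0. (- x) powr (- \<alpha>) \<ge> y_star \<alpha> \<longrightarrow>
       sums_from_1 (\<lambda>n. (- x) powr (- \<alpha> - 1) *
           (fs_coeff (1 / \<alpha>) n * sin (real n * (1 - \<rho>) * pi) * ((- x) powr (- \<alpha>)) powr (- real n / \<alpha> - 1)))
         (\<psi> \<alpha> \<rho> x)) \<and>
     (\<forall>x < 0. (- x) powr (- \<alpha>) \<le> y_star \<alpha> \<longrightarrow>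
       sums_from_1 (\<lambda>n. (- x) powr (- \<alpha> - 1) *
           (fs_coeff \<alpha> n * sin (real n * \<alpha> * (1 - \<rho>) * pi) * ((- x) powr (- \<alpha>)) ^ (n - 1)))
         (\<psi> \<alpha> \<rho> x))"
    if "1 < \<alpha> \<and> \<alpha> \<le> 2 \<and> 1 - 1 / \<alpha> \<le> \<rho> \<and> \<rho> \<le> 1 / \<alpha>" for \<alpha> \<rho>
  proof -
    from that have \<alpha>: "1 < \<alpha>" "\<alpha> \<le> 2" "1 - 1 / \<alpha> \<le> \<rho>" "\<rho> \<le> 1 / \<alpha>" by auto
    from \<alpha> have \<alpha>': "1 < \<alpha>" "\<alpha> \<le> 2" "1 - 1 / \<alpha> \<le> 1 - \<rho>" "1 - \<rho> \<le> 1 / \<alpha>" by auto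
    note adm = admissible_dual(1)[OF \<alpha>]
    show ?thesis
    proof (intro conjI allI impI)
      fix x :: real assume x: "x > 0" "x powr (- \<alpha>) \<ge> y_star \<alpha>"
      show "sums_from_1 (\<lambda>n. x powr (- \<alpha> - 1) *
           (fs_coeff (1 / \<alpha>) n * sin (real n * \<rho> * pi) * (x powr (- \<alpha>)) powr (- real n / \<alpha> - 1))) (\<psi> \<alpha> \<rho> x)"
        unfolding dual[OF \<alpha> x(1)] by (intro sums_mult dual_outside \<alpha> x)
    next
      fix x :: real assume x: "x > 0" "x powr (- \<alpha>) \<le> y_star \<alpha>"
      show "sums_from_1 (\<lambda>n. x powr (- \<alpha> - 1) *
           (fs_coeff \<alpha> n * sin (real n * \<alpha> * \<rho> * pi) * (x powr (- \<alpha>)) ^ (n - 1))) (\<psi> \<alpha> \<rho> x)"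
        unfolding dual[OF \<alpha> x(1)] by (intro sums_mult dual_inside \<alpha> x powr_ge_zero)
    next
      fix x :: real assume x: "x < 0" "(- x) powr (- \<alpha>) \<ge> y_star \<alpha>"
      then have x0: "- x > 0" by simp
      show "sums_from_1 (\<lambda>n. (- x) powr (- \<alpha> - 1) *
           (fs_coeff (1 / \<alpha>) n * sin (real n * (1 - \<rho>) * pi) * ((- x) powr (- \<alpha>)) powr (- real n / \<alpha> - 1))) (\<psi> \<alpha> \<rho> x)"
        unfolding reflect[OF adm, of x] dual[OF \<alpha>' x0] by (intro sums_mult dual_outside \<alpha>' x)
    next
      fix x :: real assume x: "x < 0" "(- x) powr (- \<alpha>) \<le> y_star \<alpha>"
      then have x0: "- x > 0" by simp
      show "sums_from_1 (\<lambda>n. (- x) powr (- \<alpha> - 1) *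
           (fs_coeff \<alpha> n * sin (real n * \<alpha> * (1 - \<rho>) * pi) * ((- x) powr (- \<alpha>)) ^ (n - 1))) (\<psi> \<alpha> \<rho> x)"
        unfolding reflect[OF adm, of x] dual[OF \<alpha>' x0] by (intro sums_mult dual_inside \<alpha>' x powr_ge_zero)
    qed (use dual_outside[OF \<alpha>] dual_inside[OF \<alpha>] dual[OF \<alpha>] in auto)
  qed

  show ?thesis
    by (rule conjI[OF _ conjI]; intro allI impI; rule small_alpha large_alpha reflect; assumption)
qed

end
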